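(* Let $p$ be a prime and let $G$ be a $p$-adic analytic pro-$p$ group of dimension $d$. Then any two approximations of the lower $p$-series of $G$ (as defined in the context) involve the same rational growth parameters: if $\bigl(j,(x_1,\ldots,x_d),(\xi_1,\ldots,\xi_d),c\bigr)$ and $\bigl(j',(x_1',\ldots,x_d'),(\xi_1',\ldots,\xi_d'),c'\bigr)$ are two approximations of the lower $p$-series of $G$, then $\xi_k=\xi_k'$ for all $k\in\{1,\ldots,d\}$.
   Context: $\mathbb{N}=\{1,2,\ldots\}$, $\mathbb{N}_0=\mathbb{N}\cup\{0\}$. The lower $p$-series of a finitely generated pro-$p$ group $G$ is defined by $P_1(G)=G$ and $P_i(G)=\overline{P_{i-1}(G)^p[P_{i-1}(G),G]}$ for $i\ge2$, where the bar denotes topological closure. A pro-$p$ group $U$ is uniformly powerful (uniform) if it is topologically finitely generated, powerful (i.e. $[U,U]\subseteq\overline{U^p}$, respectively $[U,U]\subseteq\overline{U^4}$ if $p=2$) and torsion-free. The dimension of a $p$-adic analytic pro-$p$ group is its dimension as a $p$-adic analytic group; it equals the rank (minimal number of topological generators) of any uniformly powerful open subgroup. A finite abelian group is homocyclic if it is a direct product of cyclic groups of the same order. Here an approximation of the lower $p$-series of $G$ (where $d=\dim(G)$) is a tuple $\bigl(j,(x_1,\ldots,x_d),(\xi_1,\ldots,\xi_d),c\bigr)$ such that: $j\in\mathbb{N}$ and $U=P_j(G)$ is uniformly powerful; $x_1,\ldots,x_d$ is a minimal (topological) generating system for $U$; $\xi_1,\ldots,\xi_d$ are rational numbers with $\frac1d\le\xi_1\le\ldots\le\xi_d\le1$;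 $c\in\mathbb{N}_0$; and for all $i\in\mathbb{N}$ with $i\ge\max\{j+2cd,\,6cd\}$ the products of procyclic subgroups $$\check{U}_i=\overline{\langle x_1^{\,p^{\lfloor(i-j)\xi_1\rfloor+c}}\rangle}\cdots\overline{\langle x_d^{\,p^{\lfloor(i-j)\xi_d\rfloor+c}}\rangle},\qquad \hat{U}_i=\overline{\langle x_1^{\,p^{\lfloor(i-j)\xi_1\rfloor-c}}\rangle}\cdots\overline{\langle x_d^{\,p^{\lfloor(i-j)\xi_d\rfloor-c}}\rangle}$$ are open normal subgroups of $G$ such that $\check{U}_i\subseteq P_i(G)\subseteq\hat{U}_i$ and $\hat{U}_i/\check{U}_i$ is homocyclic abelian of exponent $p^{2c}$. *)

theory Defs
  imports "HOL-Analysis.Analysis" "HOL-Algebra.QuotRing" "HOL-Algebra.Product_Groups"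
begin

section \<open>The field of \<open>p\<close>-adic numbers\<close>

definition padic_abs :: "nat \<Rightarrow> rat \<Rightarrow> real" where
  "padic_abs p q = (if q = 0 then 0 else
     real p powi (int (multiplicity (int p) (snd (quotient_of q)))
                - int (multiplicity (int p) (fst (quotient_of q)))))"

definition padic_cauchy :: "nat \<Rightarrow> (nat \<Rightarrow> rat) \<Rightarrow> bool" where
  "padic_cauchy p s \<longleftrightarrow> (\<forall>e>0. \<exists>N. \<forall>m\<ge>N. \<forall>n\<ge>N. padic_abs p (s m - s n) < e)"

definition padic_cauchy_ring :: "nat \<Rightarrow> (nat \<Rightarrow> rat) ring" where
  "padic_cauchy_ring p =
    \<lparr>carrier = Collect (padic_cauchy p), mult = (\<lambda>s t n. s n * t n), one = (\<lambda>n. 1),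
     ring.zero = (\<lambda>n. 0), add = (\<lambda>s t n. s n + t n)\<rparr>"

definition padic_null :: "nat \<Rightarrow> (nat \<Rightarrow> rat) set" where
  "padic_null p = {s. (\<lambda>n. padic_abs p (s n)) \<longlonglongrightarrow> 0}"

type_synonym padic = "(nat \<Rightarrow> rat) set"

text \<open>The field of \<open>p\<close>-adic numbers is the completion of the rationals: Cauchy sequences
  modulo null sequences.\<close>

definition Qp :: "nat \<Rightarrow> padic ring" where
  "Qp p = padic_cauchy_ring p Quot padic_null p"

definition padic_norm :: "nat \<Rightarrow> padic \<Rightarrow> real" where
  "padic_norm p X = (THE l. \<forall>s\<in>X. (\<lambda>n. padic_abs p (s n)) \<longlonglongrightarrow> l)"

definition Qp_topology :: "nat \<Rightarrow> padic topology" where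
  "Qp_topology p =
     Metric_space.mtopology (carrier (Qp p)) (\<lambda>x y. padic_norm p (x \<ominus>\<^bsub>Qp p\<^esub> y))"

definition Zp :: "nat \<Rightarrow> padic set" where
  "Zp p = {x \<in> carrier (Qp p). padic_norm p x \<le> 1}"

definition Zp_power :: "nat \<Rightarrow> nat \<Rightarrow> (nat \<Rightarrow> padic) set" where
  "Zp_power p r = ({..<r} \<rightarrow>\<^sub>E Zp p)"

definition Zp_power_topology :: "nat \<Rightarrow> nat \<Rightarrow> (nat \<Rightarrow> padic) topology" where
  "Zp_power_topology p r =
     product_topology (\<lambda>_. subtopology (Qp_topology p) (Zp p)) {..<r}"

section \<open>\<open>p\<close>-adic analytic manifolds and groups\<close>

definition padic_monomial :: "nat \<Rightarrow> nat \<Rightarrow> (nat \<Rightarrow> nat) \<Rightarrow> (nat \<Rightarrow> padic) \<Rightarrow> padic" where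
  "padic_monomial p r \<alpha> x = finprod (Qp p) (\<lambda>i. x i [^]\<^bsub>Qp p\<^esub> \<alpha> i) {..<r}"

text \<open>The power series in \<open>r\<close> variables with coefficients \<open>a\<close>, indexed by multi-indices, has
  the sum \<open>l\<close> at \<open>x\<close>, as an unordered sum.  By the ultrametric inequality and completeness this
  is the same as convergence to \<open>l\<close> with the terms tending to \<open>0\<close>.\<close>

definition padic_series_sums ::
  "nat \<Rightarrow> nat \<Rightarrow> ((nat \<Rightarrow> nat) \<Rightarrow> padic) \<Rightarrow> (nat \<Rightarrow> padic) \<Rightarrow> padic \<Rightarrow> bool" where
  "padic_series_sums p r a x l \<longleftrightarrow>
     limitin (Qp_topology p)
       (\<lambda>F. finsum (Qp p) (\<lambda>\<alpha>. a \<alpha> \<otimes>\<^bsub>Qp p\<^esub> padic_monomial p r \<alpha> x) F)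
       l (finite_subsets_at_top ({..<r} \<rightarrow>\<^sub>E UNIV))"

text \<open>The point \<open>y + p\<^sup>h x\<close>.\<close>

definition padic_shift ::
  "nat \<Rightarrow> nat \<Rightarrow> (nat \<Rightarrow> padic) \<Rightarrow> nat \<Rightarrow> (nat \<Rightarrow> padic) \<Rightarrow> (nat \<Rightarrow> padic)" where
  "padic_shift p r y h x = (\<lambda>i\<in>{..<r}. y i \<oplus>\<^bsub>Qp p\<^esub> ([(p ^ h)] \<cdot>\<^bsub>Qp p\<^esub> x i))"

text \<open>Analyticity of a map from an open subset \<open>V\<close> of the \<open>r\<close>-th power of the \<open>p\<close>-adic integers
  to the \<open>s\<close>-th power: locally around each \<open>y \<in> V\<close> it is given by power series with
  \<open>p\<close>-adic coefficients.  That \<open>V\<close> is open is implied.\<close>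

definition padic_analytic_on ::
  "nat \<Rightarrow> nat \<Rightarrow> nat \<Rightarrow> (nat \<Rightarrow> padic) set \<Rightarrow> ((nat \<Rightarrow> padic) \<Rightarrow> (nat \<Rightarrow> padic)) \<Rightarrow> bool" where
  "padic_analytic_on p r s V f \<longleftrightarrow>
     V \<subseteq> Zp_power p r \<and> f ` V \<subseteq> Zp_power p s \<and>
     (\<forall>y\<in>V. \<exists>h::nat.
        (\<forall>x\<in>Zp_power p r. padic_shift p r y h x \<in> V) \<and>
        (\<forall>k<s. \<exists>a. (\<forall>\<alpha>\<in>{..<r} \<rightarrow>\<^sub>E UNIV. a \<alpha> \<in> carrier (Qp p)) \<and>
           (\<forall>x\<in>Zp_power p r. padic_series_sums p r a x (f (padic_shift p r y h x) k))))"

type_synonym 'a padic_chart = "'a set \<times> ('a \<Rightarrow> nat \<Rightarrow> padic)"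

definition padic_chart :: "nat \<Rightarrow> nat \<Rightarrow> 'a topology \<Rightarrow> 'a padic_chart \<Rightarrow> bool" where
  "padic_chart p d X = (\<lambda>(V, \<phi>).
     openin X V \<and> openin (Zp_power_topology p d) (\<phi> ` V) \<and>
     homeomorphic_map (subtopology X V) (subtopology (Zp_power_topology p d) (\<phi> ` V)) \<phi>)"

definition padic_atlas :: "nat \<Rightarrow> nat \<Rightarrow> 'a topology \<Rightarrow> 'a padic_chart set \<Rightarrow> bool" where
  "padic_atlas p d X A \<longleftrightarrow>
     (\<forall>C\<in>A. padic_chart p d X C) \<and> \<Union> (fst ` A) = topspace X \<and>
     (\<forall>(V, \<phi>)\<in>A. \<forall>(W, \<psi>)\<in>A.
        padic_analytic_on p d d (\<phi> ` (V \<inter> W)) (\<lambda>z. \<psi> (inv_into V \<phi> z)))"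

definition padic_analytic_map ::
  "nat \<Rightarrow> nat \<Rightarrow> 'a topology \<Rightarrow> 'a padic_chart set \<Rightarrow>
   nat \<Rightarrow> 'b topology \<Rightarrow> 'b padic_chart set \<Rightarrow> ('a \<Rightarrow> 'b) \<Rightarrow> bool" where
  "padic_analytic_map p d X A e Y B f \<longleftrightarrow>
     continuous_map X Y f \<and>
     (\<forall>(V, \<phi>)\<in>A. \<forall>(W, \<psi>)\<in>B.
        padic_analytic_on p d e (\<phi> ` (V \<inter> f -` W)) (\<lambda>z. \<psi> (f (inv_into V \<phi> z))))"

definition padic_prod_atlas ::
  "nat \<Rightarrow> 'a padic_chart set \<Rightarrow> nat \<Rightarrow> 'b padic_chart set \<Rightarrow> ('a \<times> 'b) padic_chart set" where
  "padic_prod_atlas d A e B =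
     (\<lambda>((V, \<phi>), (W, \<psi>)).
        (V \<times> W, \<lambda>(a, b). \<lambda>i\<in>{..<d + e}. if i < d then \<phi> a i else \<psi> b (i - d))) ` (A \<times> B)"

definition topological_group :: "('a, 'b) monoid_scheme \<Rightarrow> 'a topology \<Rightarrow> bool" where
  "topological_group G T \<longleftrightarrow>
     group G \<and> topspace T = carrier G \<and>
     continuous_map (prod_topology T T) T (\<lambda>(x, y). x \<otimes>\<^bsub>G\<^esub> y) \<and>
     continuous_map T T (\<lambda>x. inv\<^bsub>G\<^esub> x)"

definition padic_analytic_group ::
  "nat \<Rightarrow> nat \<Rightarrow> ('a, 'b) monoid_scheme \<Rightarrow> 'a topology \<Rightarrow> bool" where
  "padic_analytic_group p d G T \<longleftrightarrow>
     topological_group G T \<and>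
     (\<exists>A. padic_atlas p d T A \<and>
        padic_analytic_map p (d + d) (prod_topology T T) (padic_prod_atlas d A d A) d T A
          (\<lambda>(x, y). x \<otimes>\<^bsub>G\<^esub> y) \<and>
        padic_analytic_map p d T A d T A (\<lambda>x. inv\<^bsub>G\<^esub> x))"

section \<open>Pro-\<open>p\<close> groups\<close>

definition profinite_group :: "('a, 'b) monoid_scheme \<Rightarrow> 'a topology \<Rightarrow> bool" where
  "profinite_group G T \<longleftrightarrow>
     topological_group G T \<and> compact_space T \<and> Hausdorff_space T \<and>
     (\<forall>V. openin T V \<and> \<one>\<^bsub>G\<^esub> \<in> V \<longrightarrow> (\<exists>H. subgroup H G \<and> openin T H \<and> H \<subseteq> V))"

definition pro_p_group :: "nat \<Rightarrow> ('a, 'b) monoid_scheme \<Rightarrow> 'a topology \<Rightarrow> bool" where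
  "pro_p_group p G T \<longleftrightarrow>
     profinite_group G T \<and>
     (\<forall>N. N \<lhd> G \<and> openin T N \<longrightarrow> (\<exists>n. card (rcosets\<^bsub>G\<^esub> N) = p ^ n))"

definition topologically_generates ::
  "('a, 'b) monoid_scheme \<Rightarrow> 'a topology \<Rightarrow> 'a set \<Rightarrow> bool" where
  "topologically_generates G T S \<longleftrightarrow>
     S \<subseteq> carrier G \<and> T closure_of (generate G S) = carrier G"

text \<open>Minimality is with respect to inclusion; it is stated for index sets, so that repetitions
  among the generators are excluded.\<close>

definition minimal_generating_system ::
  "('a, 'b) monoid_scheme \<Rightarrow> 'a topology \<Rightarrow> nat \<Rightarrow> (nat \<Rightarrow> 'a) \<Rightarrow> bool" where
  "minimal_generating_system G T d x \<longleftrightarrow>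
     topologically_generates G T (x ` {1..d}) \<and>
     (\<forall>J. J \<subset> {1..d} \<longrightarrow> \<not> topologically_generates G T (x ` J))"

definition power_subgroup :: "('a, 'b) monoid_scheme \<Rightarrow> 'a set \<Rightarrow> nat \<Rightarrow> 'a set" where
  "power_subgroup G H n = generate G ((\<lambda>h. h [^]\<^bsub>G\<^esub> n) ` H)"

definition commutator_subgroup ::
  "('a, 'b) monoid_scheme \<Rightarrow> 'a set \<Rightarrow> 'a set \<Rightarrow> 'a set" where
  "commutator_subgroup G H K =
     generate G (\<Union>h\<in>H. \<Union>k\<in>K. {h \<otimes>\<^bsub>G\<^esub> k \<otimes>\<^bsub>G\<^esub> inv\<^bsub>G\<^esub> h \<otimes>\<^bsub>G\<^esub> inv\<^bsub>G\<^esub> k})"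

definition powerful :: "nat \<Rightarrow> ('a, 'b) monoid_scheme \<Rightarrow> 'a topology \<Rightarrow> bool" where
  "powerful p G T \<longleftrightarrow>
     commutator_subgroup G (carrier G) (carrier G)
       \<subseteq> T closure_of (power_subgroup G (carrier G) (if p = 2 then 4 else p))"

definition torsion_free :: "('a, 'b) monoid_scheme \<Rightarrow> bool" where
  "torsion_free G \<longleftrightarrow> (\<forall>x\<in>carrier G. \<forall>n::nat. n > 0 \<and> x [^]\<^bsub>G\<^esub> n = \<one>\<^bsub>G\<^esub> \<longrightarrow> x = \<one>\<^bsub>G\<^esub>)"

definition uniformly_powerful :: "nat \<Rightarrow> ('a, 'b) monoid_scheme \<Rightarrow> 'a topology \<Rightarrow> bool" where
  "uniformly_powerful p G T \<longleftrightarrow>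
     pro_p_group p G T \<and> (\<exists>S. finite S \<and> topologically_generates G T S) \<and>
     powerful p G T \<and> torsion_free G"

text \<open>The series starts at index \<open>1\<close>; the value at \<open>0\<close> is a dummy.\<close>

primrec lower_p_series ::
  "nat \<Rightarrow> ('a, 'b) monoid_scheme \<Rightarrow> 'a topology \<Rightarrow> nat \<Rightarrow> 'a set" where
  "lower_p_series p G T 0 = carrier G"
| "lower_p_series p G T (Suc i) =
     (if i = 0 then carrier G
      else T closure_of
        (power_subgroup G (lower_p_series p G T i) p <#>\<^bsub>G\<^esub>
         commutator_subgroup G (lower_p_series p G T i) (carrier G)))"

section \<open>Approximations of the lower \<open>p\<close>-series\<close>

definition homocyclic :: "('a, 'b) monoid_scheme \<Rightarrow> bool" where
  "homocyclic G \<longleftrightarrow> (\<exists>n m. m > 0 \<and> G \<cong> product_group {..<n} (\<lambda>_::nat. integer_mod_group m))"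

definition has_exponent :: "('a, 'b) monoid_scheme \<Rightarrow> nat \<Rightarrow> bool" where
  "has_exponent G e \<longleftrightarrow>
     e > 0 \<and> (\<forall>x\<in>carrier G. x [^]\<^bsub>G\<^esub> e = \<one>\<^bsub>G\<^esub>) \<and>
     (\<forall>e'>0. (\<forall>x\<in>carrier G. x [^]\<^bsub>G\<^esub> e' = \<one>\<^bsub>G\<^esub>) \<longrightarrow> e \<le> e')"

definition procyclic :: "('a, 'b) monoid_scheme \<Rightarrow> 'a topology \<Rightarrow> 'a \<Rightarrow> 'a set" where
  "procyclic G T x = T closure_of (generate G {x})"

primrec set_product :: "('a, 'b) monoid_scheme \<Rightarrow> nat \<Rightarrow> (nat \<Rightarrow> 'a set) \<Rightarrow> 'a set" where
  "set_product G 0 H = {\<one>\<^bsub>G\<^esub>}"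
| "set_product G (Suc d) H = set_product G d H <#>\<^bsub>G\<^esub> H (Suc d)"

definition approx_lower ::
  "nat \<Rightarrow> ('a, 'b) monoid_scheme \<Rightarrow> 'a topology \<Rightarrow> nat \<Rightarrow>
   nat \<Rightarrow> (nat \<Rightarrow> 'a) \<Rightarrow> (nat \<Rightarrow> rat) \<Rightarrow> nat \<Rightarrow> nat \<Rightarrow> 'a set" where
  "approx_lower p G T d j x \<xi> c i =
     set_product G d (\<lambda>k. procyclic G T
       (x k [^]\<^bsub>G\<^esub> (p ^ (nat \<lfloor>of_nat (i - j) * \<xi> k\<rfloor> + c))))"

definition approx_upper ::
  "nat \<Rightarrow> ('a, 'b) monoid_scheme \<Rightarrow> 'a topology \<Rightarrow> nat \<Rightarrow>
   nat \<Rightarrow> (nat \<Rightarrow> 'a) \<Rightarrow> (nat \<Rightarrow> rat) \<Rightarrow> nat \<Rightarrow> nat \<Rightarrow> 'a set" where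
  "approx_upper p G T d j x \<xi> c i =
     set_product G d (\<lambda>k. procyclic G T
       (x k [^]\<^bsub>G\<^esub> (p ^ (nat \<lfloor>of_nat (i - j) * \<xi> k\<rfloor> - c))))"

text \<open>For the indices \<open>i\<close> considered below, \<open>i - j \<ge> 2cd\<close> and \<open>\<xi> k \<ge> 1/d\<close>, so that none of the
  truncated subtractions and conversions in the exponents above takes effect.\<close>

definition lower_p_series_approximation ::
  "nat \<Rightarrow> ('a, 'b) monoid_scheme \<Rightarrow> 'a topology \<Rightarrow> nat \<Rightarrow>
   nat \<Rightarrow> (nat \<Rightarrow> 'a) \<Rightarrow> (nat \<Rightarrow> rat) \<Rightarrow> nat \<Rightarrow> bool" where
  "lower_p_series_approximation p G T d j x \<xi> c \<longleftrightarrow>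
     (let P = lower_p_series p G T; U = G\<lparr>carrier := P j\<rparr> in
      j \<ge> 1 \<and>
      uniformly_powerful p U (subtopology T (P j)) \<and>
      minimal_generating_system U (subtopology T (P j)) d x \<and>
      (\<forall>k\<in>{1..d}. 1 / of_nat d \<le> \<xi> k \<and> \<xi> k \<le> 1) \<and>
      (\<forall>k\<in>{1..d}. \<forall>l\<in>{1..d}. k \<le> l \<longrightarrow> \<xi> k \<le> \<xi> l) \<and>
      (\<forall>i\<ge>1. i \<ge> max (j + 2 * c * d) (6 * c * d) \<longrightarrow>
        (let L = approx_lower p G T d j x \<xi> c i; M = approx_upper p G T d j x \<xi> c i in
         L \<lhd> G \<and> openin T L \<and> M \<lhd> G \<and> openin T M \<and>
         L \<subseteq> P i \<and> P i \<subseteq> M \<and>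
         homocyclic (G\<lparr>carrier := M\<rparr> Mod L) \<and>
         has_exponent (G\<lparr>carrier := M\<rparr> Mod L) (p ^ (2 * c)))))"

end

theory Submission
  imports Defs "HOL-Algebra.Group_Action" "HOL-Algebra.Multiplicative_Group"
    "HOL-Algebra.Zassenhaus"
begin

text \<open>Let \<open>U\<close> be the uniform subgroup of an approximation and \<open>U\<^sub>n\<close> its lower \<open>p\<close>-series,
  numbered so that \<open>U\<^sub>0 = U\<close>. Since \<open>U\<close> is powerful, the \<open>p\<close>-th power map induces surjections
  \<open>U\<^sub>n / U\<^sub>n\<^sub>+\<^sub>1 \<rightarrow> U\<^sub>n\<^sub>+\<^sub>1 / U\<^sub>n\<^sub>+\<^sub>2\<close>; torsion-freeness and compactness make them injective, so \<open>U\<^sub>n\<close> has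
  index \<open>p\<^sup>d\<^sup>n\<close>.  Now consider open normal subgroups \<open>N\<close> of \<open>G\<close> that contain the \<open>i\<close>-th term of the
  lower \<open>p\<close>-series of \<open>G\<close> and all \<open>p\<^sup>m\<close>-th powers. The lower approximations force the index of each
  such \<open>N\<close> to be at most \<open>p\<close> to the \<open>\<Sum>\<^sub>k min m (i \<xi>\<^sub>k) + O(1)\<close>, while the upper approximations
  yield one whose index is at least that large. Hence the function
  \<open>t \<mapsto> \<Sum>\<^sub>k min t \<xi>\<^sub>k\<close> depends on \<open>G\<close> only, and it determines the sorted tuple \<open>\<xi>\<close>.\<close>

section \<open>Congruences modulo a normal subgroup\<close>

text \<open>The index of the \<open>i\<close>-th term of the lower \<open>p\<close>-series alone
  would reveal only the sum of the \<open>\<xi> k\<close>. Forcing all \<open>p^m\<close>-th powers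
  into \<open>N\<close> caps the contribution of the \<open>k\<close>-th generator at
  \<open>m\<close>, and letting \<open>m\<close> grow proportionally to \<open>i\<close> makes every
  single parameter visible: the resulting function of \<open>t\<close> is piecewise linear, and its
  right-hand slope at \<open>t\<close> is the number of \<open>k\<close> with
  \<open>\<xi> k > t\<close>. The two approximations may live on different uniform subgroups with
  different constants; these effects are bounded and vanish after division by \<open>i\<close>. One
  obstacle is that the \<open>p\<close>-th power map is not a homomorphism. It becomes one modulo a
  deeper term of the series, where the correction is a commutator raised to
  \<open>p choose 2\<close>; odd \<open>p\<close> divides this number, while for
  \<open>p = 2\<close> the fourth powers in the definition of powerful must push commutators one
  level further down. The other obstacle is openness: the terms of the series are not open by
  construction, and openness has to be proved together with the surjectivity of the power
  maps.\<close>

abbreviation commutator :: "('a, 'b) monoid_scheme \<Rightarrow> 'a \<Rightarrow> 'a \<Rightarrow> 'a" where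
  "commutator G h k \<equiv> h \<otimes>\<^bsub>G\<^esub> k \<otimes>\<^bsub>G\<^esub> inv\<^bsub>G\<^esub> h \<otimes>\<^bsub>G\<^esub> inv\<^bsub>G\<^esub> k"

lemma (in group) mult_cancel_simps [simp]:
  assumes "x \<in> carrier G" "y \<in> carrier G"
  shows "x \<otimes> (inv x \<otimes> y) = y" "inv x \<otimes> (x \<otimes> y) = y"
  using assms by (simp_all flip: m_assoc)

text \<open>Collection in nilpotency class two: \<open>w\<close> commutes with \<open>x\<close> and
  \<open>z\<close>, and each of the \<open>n choose 2\<close> pairs in which a \<open>z\<close> has
  to pass an \<open>x\<close> contributes one factor \<open>w\<close>.\<close>

lemma (in group) pow_mult_central_commutator:
  assumes [simp]: "x \<in> carrier G" "z \<in> carrier G" "w \<in> carrier G"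
    and zx: "z \<otimes> x = w \<otimes> x \<otimes> z" and wx: "w \<otimes> x = x \<otimes> w" and wz: "w \<otimes> z = z \<otimes> w"
  shows "(x \<otimes> z) [^] (n::nat) = w [^] (n choose 2) \<otimes> x [^] n \<otimes> z [^] n"
proof (induction n)
  case (Suc n)
  have comm: "a [^] k \<otimes> b = b \<otimes> a [^] k" if "a \<in> carrier G" "b \<in> carrier G" "a \<otimes> b = b \<otimes> a"
    for a b and k :: nat
  proof (induction k)
    case (Suc k)
    have "a [^] Suc k \<otimes> b = a [^] k \<otimes> b \<otimes> a" using that by (simp add: m_assoc)
    thus ?case using Suc that by (simp add: m_assoc)
  qed (use that in simp)
  have z: "z [^] k \<otimes> x = w [^] k \<otimes> x \<otimes> z [^] k" for k :: nat
  proof (induction k)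
    case (Suc k)
    have "z [^] Suc k \<otimes> x = z [^] k \<otimes> (w \<otimes> x \<otimes> z)" by (simp add: m_assoc zx)
    also have "\<dots> = w \<otimes> (z [^] k \<otimes> x) \<otimes> z"
      using comm[of z w k] wz by (simp flip: m_assoc)
    also have "\<dots> = w [^] Suc k \<otimes> x \<otimes> z [^] Suc k"
      by (simp only: Suc nat_pow_Suc2[OF assms(3)] nat_pow_Suc[of z]) (simp add: m_assoc)
    finally show ?case .
  qed simp
  have "(x \<otimes> z) [^] Suc n = w [^] (n choose 2) \<otimes> x [^] n \<otimes> (z [^] n \<otimes> x) \<otimes> z"
    by (simp add: Suc m_assoc)
  also have "\<dots> = w [^] (n choose 2) \<otimes> (x [^] n \<otimes> w [^] n) \<otimes> x \<otimes> z [^] n \<otimes> z"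
    by (simp add: z m_assoc)
  also have "x [^] n \<otimes> w [^] n = w [^] n \<otimes> x [^] n"
    using comm[of x "w [^] n" n] comm[of w x n] wx by simp
  also have "w [^] (n choose 2) \<otimes> (w [^] n \<otimes> x [^] n) \<otimes> x \<otimes> z [^] n \<otimes> z
      = w [^] (Suc n choose 2) \<otimes> x [^] Suc n \<otimes> z [^] Suc n"
  proof -
    have "Suc n choose 2 = (n choose 2) + n" by (simp add: numeral_2_eq_2)
    thus ?thesis by (simp add: m_assoc flip: nat_pow_mult)
  qed
  finally show ?case .
qed (simp add: numeral_2_eq_2)

text \<open>For odd \<open>p\<close> the exponent \<open>p choose 2\<close> is a multiple of
  \<open>p\<close>, so \<open>wp\<close> kills the correction; for \<open>p = 2\<close> it equals 1,
  and \<open>w\<close> itself must be trivial.\<close>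

lemma (in group) pow_prime_mult:
  assumes "prime (p::nat)" and x: "x \<in> carrier G" and z: "z \<in> carrier G" and w: "w \<in> carrier G"
    and "z \<otimes> x = w \<otimes> x \<otimes> z" "w \<otimes> x = x \<otimes> w" "w \<otimes> z = z \<otimes> w"
    and wp: "w [^] p = \<one>" and "p = 2 \<Longrightarrow> w = \<one>"
  shows "(x \<otimes> z) [^] p = x [^] p \<otimes> z [^] p"
proof -
  have "w [^] (p choose 2) = \<one>"
  proof (cases "p = 2")
    case False
    hence "2 < p" using prime_ge_2_nat[OF assms(1)] by linarith
    hence "p dvd p choose 2" using dvd_choose_prime[of 2 p] assms(1) by simp
    then obtain k where "p choose 2 = p * k" by auto
    thus ?thesis using wp w by (simp flip: nat_pow_pow)
  qed (simp add: assms)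
  thus ?thesis using pow_mult_central_commutator[OF x z w assms(5-7), of p] x z by simp
qed

lemma (in group) commutator_mult:
  assumes "x \<in> carrier G" "y \<in> carrier G"
  shows "commutator G x y \<otimes> y \<otimes> x = x \<otimes> y"
  using assms by (simp add: m_assoc)

context normal
begin

lemma rcos_eq_iff:
  assumes "x \<in> carrier G" "y \<in> carrier G"
  shows "H #> x = H #> y \<longleftrightarrow> x \<otimes> inv y \<in> H"
  using assms rcos_module[OF is_group, of y x] repr_independence[OF _ _ is_subgroup, of x y] rcos_self[OF _ is_subgroup, of x]
  by (metis)

lemma rcos_eq_self_iff:
  assumes "x \<in> carrier G" shows "H #> x = H \<longleftrightarrow> x \<in> H"
  using assms coset_join1[OF _ _ is_subgroup] coset_join2[OF _ is_subgroup] subset by blast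

lemma rcos_mult_cong:
  assumes "a \<in> carrier G" "a' \<in> carrier G" "b \<in> carrier G" "b' \<in> carrier G"
    and "H #> a = H #> a'" "H #> b = H #> b'"
  shows "H #> (a \<otimes> b) = H #> (a' \<otimes> b')"
  using assms rcos_sum[of a b] rcos_sum[of a' b'] by simp

lemma rcos_inv_cong:
  assumes "a \<in> carrier G" "b \<in> carrier G" "H #> a = H #> b"
  shows "H #> inv a = H #> inv b"
  using assms rcos_inv[of a] rcos_inv[of b] by simp

lemma rcos_mem_cong:
  assumes "a \<in> carrier G" "b \<in> carrier G" "H #> a = H #> b"
  shows "a \<in> H \<longleftrightarrow> b \<in> H"
  using assms rcos_eq_self_iff by metis

lemma rcos_commute_iff:
  assumes "x \<in> carrier G" "y \<in> carrier G"
  shows "H #> (x \<otimes> y) = H #> (y \<otimes> x) \<longleftrightarrow> commutator G x y \<in> H"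
  using assms rcos_eq_iff[of "x \<otimes> y" "y \<otimes> x"] by (simp add: inv_mult_group m_assoc)

lemma commutator_in:
  assumes "x \<in> H" "y \<in> carrier G" shows "commutator G x y \<in> H"
proof -
  have "x \<otimes> (y \<otimes> inv x \<otimes> inv y) \<in> H"
    using assms by (intro subgroup.m_closed[OF is_subgroup] inv_op_closed2) (auto intro: subgroup.m_inv_closed[OF is_subgroup])
  thus ?thesis using assms by (simp add: m_assoc)
qed

text \<open>The first two commutator hypotheses say that \<open>x\<close> and \<open>z\<close>
  generate a group of class at most two modulo \<open>H\<close>.\<close>

lemma pow_prime_mult_mod:
  assumes "prime (p::nat)" and x: "x \<in> carrier G" and z: "z \<in> carrier G"
    and "commutator G (commutator G z x) x \<in> H" "commutator G (commutator G z x) z \<in> H" and "commutator G z x [^] p \<in> H"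
    and "p = 2 \<Longrightarrow> commutator G z x \<in> H"
  shows "H #> ((x \<otimes> z) [^] p) = H #> (x [^] p \<otimes> z [^] p)"
proof -
  interpret Q: group "G Mod H" by (rule factorgroup_is_group)
  have c: "H #> a \<in> carrier (G Mod H)" if "a \<in> carrier G" for a
    using that by (auto simp: carrier_FactGroup)
  let ?w = "commutator G z x"
  have w: "?w \<in> carrier G" using x z by simp
  have m: "(H #> a) <#> (H #> b) = H #> (a \<otimes> b)" if "a \<in> carrier G" "b \<in> carrier G" for a b
    using that rcos_sum by simp
  have pw: "(H #> a) [^]\<^bsub>G Mod H\<^esub> n = H #> (a [^] n)" if "a \<in> carrier G" for a and n :: nat
    using that FactGroup_pow by simp
  have "((H #> x) \<otimes>\<^bsub>G Mod H\<^esub> (H #> z)) [^]\<^bsub>G Mod H\<^esub> p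
      = ((H #> x) [^]\<^bsub>G Mod H\<^esub> p) \<otimes>\<^bsub>G Mod H\<^esub> ((H #> z) [^]\<^bsub>G Mod H\<^esub> p)"
  proof (rule Q.pow_prime_mult[OF assms(1) c[OF x] c[OF z] c[OF w]])
    show "(H #> z) \<otimes>\<^bsub>G Mod H\<^esub> (H #> x) = (H #> ?w) \<otimes>\<^bsub>G Mod H\<^esub> (H #> x) \<otimes>\<^bsub>G Mod H\<^esub> (H #> z)"
      using x z w commutator_mult[OF z x] by (simp add: m)
    show "(H #> ?w) \<otimes>\<^bsub>G Mod H\<^esub> (H #> x) = (H #> x) \<otimes>\<^bsub>G Mod H\<^esub> (H #> ?w)"
      using x w rcos_commute_iff[OF w x] assms(4) by (simp add: m)
    show "(H #> ?w) \<otimes>\<^bsub>G Mod H\<^esub> (H #> z) = (H #> z) \<otimes>\<^bsub>G Mod H\<^esub> (H #> ?w)"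
      using z w rcos_commute_iff[OF w z] assms(5) by (simp add: m)
    show "(H #> ?w) [^]\<^bsub>G Mod H\<^esub> p = \<one>\<^bsub>G Mod H\<^esub>"
      using assms(6) pw[OF w] rcos_eq_self_iff[of "?w [^] p"] w by simp
    show "H #> ?w = \<one>\<^bsub>G Mod H\<^esub>" if "p = 2"
      using assms(7)[OF that] rcos_eq_self_iff[OF w] by simp
  qed
  thus ?thesis using x z by (simp add: m pw)
qed

end

section \<open>Topological groups\<close>

locale top_group = group G for G :: "('a, 'b) monoid_scheme" (structure) +
  fixes T :: "'a topology"
  assumes topological_group: "topological_group G T"
begin

lemma topspace [simp]: "topspace T = carrier G"
  using topological_group by (simp add: topological_group_def)

lemma open_subset: "openin T N \<Longrightarrow> N \<subseteq> carrier G"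
  using openin_subset by fastforce

lemma continuous_mult:
  assumes "continuous_map X T f" "continuous_map X T g"
  shows "continuous_map X T (\<lambda>x. f x \<otimes> g x)"
proof -
  have "continuous_map (prod_topology T T) T (\<lambda>(x, y). x \<otimes> y)"
    using topological_group by (simp add: topological_group_def)
  moreover have "continuous_map X (prod_topology T T) (\<lambda>x. (f x, g x))"
    using assms by (simp add: continuous_map_paired)
  ultimately have "continuous_map X T ((\<lambda>(x, y). x \<otimes> y) \<circ> (\<lambda>x. (f x, g x)))"
    by (rule continuous_map_compose[rotated])
  thus ?thesis by (simp add: comp_def)
qed

lemma continuous_pow: "continuous_map T T (\<lambda>x. x [^] (n::nat))"
  by (induction n) (auto intro!: continuous_mult)

lemma open_preimage:
  assumes "continuous_map T T f" "openin T N"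
  shows "openin T {x \<in> carrier G. f x \<in> N}"
  using openin_continuous_map_preimage[OF assms] by simp

lemma open_right_preimage:
  assumes "a \<in> carrier G" "openin T N" shows "openin T {x \<in> carrier G. x \<otimes> a \<in> N}"
  using assms by (intro open_preimage continuous_mult) auto

lemma open_subgroup_mono:
  assumes "subgroup N G" "openin T N" "subgroup H G" "N \<subseteq> H"
  shows "openin T H"
proof (subst openin_subopen, intro ballI)
  fix h assume h: "h \<in> H"
  interpret H: subgroup H G by fact
  interpret N: subgroup N G by fact
  have hc: "h \<in> carrier G" using h by auto
  let ?O = "{x \<in> carrier G. x \<otimes> inv h \<in> N}"
  have "?O \<subseteq> H"
  proof
    fix x assume x: "x \<in> ?O"
    hence "x \<otimes> inv h \<in> H" using assms(4) by auto
    hence "x \<otimes> inv h \<otimes> h \<in> H" using h by (rule H.m_closed)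
    thus "x \<in> H" using x hc by (simp add: m_assoc)
  qed
  moreover have "openin T ?O" using hc assms by (intro open_right_preimage) auto
  ultimately show "\<exists>O'. openin T O' \<and> h \<in> O' \<and> O' \<subseteq> H" using hc by (intro exI[of _ ?O]) auto
qed

text \<open>The coset of \<open>N\<close> through \<open>z\<close>, called \<open>B\<close> below,
  is an open neighbourhood of \<open>z\<close> and therefore meets \<open>A\<close>.\<close>

lemma closure_subset_mult:
  assumes "subgroup N G" "openin T N" "A \<subseteq> carrier G"
  shows "T closure_of A \<subseteq> N <#> A"
proof
  fix z assume z: "z \<in> T closure_of A"
  interpret N: subgroup N G by fact
  have zc: "z \<in> carrier G" using z by (simp add: in_closure_of)
  define B where "B = {y \<in> carrier G. y \<otimes> inv z \<in> N}"
  have "openin T B" unfolding B_def using zc assms by (intro open_right_preimage) auto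
  moreover have "z \<in> B" using zc by (simp add: B_def)
  ultimately have "\<exists>a. a \<in> A \<and> a \<in> B" using z by (simp add: in_closure_of)
  then obtain a where a: "a \<in> A" "a \<otimes> inv z \<in> N" by (auto simp: B_def)
  hence "inv (a \<otimes> inv z) \<in> N" by simp
  hence "inv (a \<otimes> inv z) \<otimes> a \<in> N <#> A" unfolding set_mult_def using a(1) by blast
  moreover have "a \<in> carrier G" using a(1) assms(3) by blast
  hence "inv (a \<otimes> inv z) \<otimes> a = z" using zc by (simp add: inv_mult_group m_assoc)
  ultimately show "z \<in> N <#> A" by simp
qed

lemma closure_subset_open_subgroup:
  assumes "subgroup N G" "openin T N" "A \<subseteq> N"
  shows "T closure_of A \<subseteq> N"
proof -
  interpret N: subgroup N G by fact
  have "N <#> A \<subseteq> N" using assms(3) by (auto simp: set_mult_def)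
  thus ?thesis using closure_subset_mult[OF assms(1,2), of A] assms(3) N.subset by blast
qed

lemma open_subgroup_closed:
  assumes "subgroup N G" "openin T N" shows "closedin T N"
proof -
  interpret N: subgroup N G by fact
  show ?thesis using closure_subset_open_subgroup[OF assms order_refl] N.subset
    by (metis closure_of_subset_eq topspace)
qed

end

locale compact_top_group = top_group +
  assumes compact: "compact_space T"
begin

text \<open>Finite index is recorded by a finite set \<open>F\<close> meeting every coset. Redundant
  representatives are allowed, so such covers are easy to multiply and to push through power
  maps.\<close>

lemma open_subgroup_finite_index:
  assumes "subgroup N G" "openin T N"
  obtains F where "finite F" "F \<subseteq> carrier G" "carrier G \<subseteq> N <#> F"
proof -
  interpret N: subgroup N G by fact
  define U where "U g = {y \<in> carrier G. y \<otimes> inv g \<in> N}" for g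
  have "compactin T (carrier G)" using compact by (simp add: compact_space_def)
  moreover have "openin T B" if "B \<in> U ` carrier G" for B
    using that assms by (auto simp: U_def intro!: open_right_preimage)
  moreover have "carrier G \<subseteq> \<Union> (U ` carrier G)" by (auto simp: U_def)
  ultimately obtain \<F> where F: "finite \<F>" "\<F> \<subseteq> U ` carrier G" "carrier G \<subseteq> \<Union> \<F>"
    unfolding compactin_def by meson
  then obtain F where F': "F \<subseteq> carrier G" "finite F" "\<F> = U ` F"
    by (meson finite_subset_image)
  have "x \<in> N <#> F" if x: "x \<in> carrier G" for x
  proof -
    obtain f where f: "f \<in> F" "x \<in> U f" using F F' x by auto
    hence "x \<otimes> inv f \<otimes> f \<in> N <#> F" unfolding set_mult_def U_def by blast
    thus ?thesis using f F' x by (auto simp: m_assoc)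
  qed
  thus ?thesis using F' that by blast
qed

text \<open>In \<open>g = h f\<close>, with \<open>f\<close> among finitely many representatives,
  conjugation by \<open>h\<close> preserves \<open>H\<close>; the intersection of all conjugates is
  thus a finite one and stays open. The last clause makes the core as large as possible and is used
  later to show which elements it contains.\<close>

lemma open_normal_core:
  assumes "subgroup H G" "openin T H"
  obtains N where "N \<lhd> G" "openin T N" "N \<subseteq> H"
    "\<And>x. x \<in> carrier G \<Longrightarrow> (\<And>g. g \<in> carrier G \<Longrightarrow> g \<otimes> x \<otimes> inv g \<in> H) \<Longrightarrow> x \<in> N"
proof -
  interpret H: subgroup H G by fact
  obtain F where F: "finite F" "F \<subseteq> carrier G" "carrier G \<subseteq> H <#> F"
    using open_subgroup_finite_index[OF assms] .
  define N where "N = {x \<in> carrier G. \<forall>g\<in>carrier G. g \<otimes> x \<otimes> inv g \<in> H}"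
  have "N = carrier G \<inter> (\<Inter>g\<in>F. {x \<in> carrier G. g \<otimes> x \<otimes> inv g \<in> H})" (is "_ = ?R")
  proof
    show "N \<subseteq> ?R" using F by (auto simp: N_def)
    show "?R \<subseteq> N"
    proof
      fix x assume x: "x \<in> ?R"
      have "g \<otimes> x \<otimes> inv g \<in> H" if g: "g \<in> carrier G" for g
      proof -
        obtain h f where h: "h \<in> H" "f \<in> F" "g = h \<otimes> f" using F g unfolding set_mult_def by blast
        hence fc: "f \<in> carrier G" using F by auto
        have "h \<otimes> (f \<otimes> x \<otimes> inv f) \<otimes> inv h \<in> H" using h x by auto
        thus ?thesis using h fc x by (simp add: m_assoc inv_mult_group)
      qed
      thus "x \<in> N" using x by (auto simp: N_def)
    qed
  qed
  moreover have "openin T {x \<in> carrier G. g \<otimes> x \<otimes> inv g \<in> H}" if "g \<in> F" for g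
    using that F assms by (intro open_preimage continuous_mult) auto
  ultimately have "openin T N"
    using F openin_topspace[of T]
    by (cases "F = {}") (auto intro!: openin_Int openin_INT)
  moreover have "N \<lhd> G"
  proof -
    have "subgroup N G"
    proof (rule subgroupI)
      show "N \<noteq> {}" by (auto simp: N_def intro!: exI[of _ \<one>])
      show "inv a \<in> N" if "a \<in> N" for a
      proof -
        have "g \<otimes> inv a \<otimes> inv g \<in> H" if g: "g \<in> carrier G" for g
        proof -
          have "inv (g \<otimes> a \<otimes> inv g) \<in> H" using \<open>a \<in> N\<close> g by (auto simp: N_def)
          thus ?thesis using \<open>a \<in> N\<close> g by (simp add: N_def inv_mult_group m_assoc)
        qed
        thus ?thesis using that by (auto simp: N_def)
      qed
      show "a \<otimes> b \<in> N" if "a \<in> N" "b \<in> N" for a b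
      proof -
        have "g \<otimes> (a \<otimes> b) \<otimes> inv g \<in> H" if g: "g \<in> carrier G" for g
        proof -
          have "(g \<otimes> a \<otimes> inv g) \<otimes> (g \<otimes> b \<otimes> inv g) \<in> H"
            using \<open>a \<in> N\<close> \<open>b \<in> N\<close> g by (auto simp: N_def)
          moreover have "(g \<otimes> a \<otimes> inv g) \<otimes> (g \<otimes> b \<otimes> inv g) = g \<otimes> (a \<otimes> b) \<otimes> inv g"
            using \<open>a \<in> N\<close> \<open>b \<in> N\<close> g by (simp add: N_def m_assoc)
          ultimately show ?thesis by simp
        qed
        thus ?thesis using that by (auto simp: N_def)
      qed
    qed (auto simp: N_def)
    moreover have "x \<otimes> h \<otimes> inv x \<in> N" if x: "x \<in> carrier G" and h: "h \<in> N" for x h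
    proof -
      have "g \<otimes> (x \<otimes> h \<otimes> inv x) \<otimes> inv g \<in> H" if "g \<in> carrier G" for g
      proof -
        have "(g \<otimes> x) \<otimes> h \<otimes> inv (g \<otimes> x) \<in> H" using x h that by (auto simp: N_def)
        thus ?thesis using x h that by (simp add: N_def m_assoc inv_mult_group)
      qed
      thus ?thesis using x h by (auto simp: N_def)
    qed
    ultimately show ?thesis by (simp add: normal_inv_iff)
  qed
  moreover have "N \<subseteq> H"
  proof
    fix x assume "x \<in> N"
    hence "x \<in> carrier G" "\<one> \<otimes> x \<otimes> inv \<one> \<in> H" unfolding N_def by blast+
    thus "x \<in> H" by simp
  qed
  ultimately show ?thesis using that[of N] by (auto simp: N_def)
qed

end

section \<open>Central series of pro-p groups\<close>

text \<open>The class equation gives a nontrivial central element, and its last nontrivial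
  \<open>p\<close>-power power has order \<open>p\<close>.\<close>

lemma (in group) p_group_central_element:
  assumes "prime (p::nat)" and ord: "order G = p ^ k" and k: "k > 0"
  obtains z where "z \<in> carrier G" "z \<noteq> \<one>" "z [^] p = \<one>" "\<And>u. u \<in> carrier G \<Longrightarrow> z \<otimes> u = u \<otimes> z"
proof -
  define \<phi> where "\<phi> = (\<lambda>g. (\<lambda>h \<in> carrier G. g \<otimes> h \<otimes> inv g))"
  interpret group_action G "carrier G" \<phi> unfolding \<phi>_def by (rule action_by_conjugation)
  have p: "p > 1" using assms(1) prime_gt_1_nat by blast
  have fin: "finite (carrier G)" using ord p order_gt_0_iff_finite by simp
  have card_orbit: "\<exists>i\<le>k. card (orbit G \<phi> x) = p ^ i" if "x \<in> carrier G" for x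
    using orbit_stabilizer_theorem[OF that] ord assms(1) by (metis divides_primepow_nat dvd_triv_left)
  have mem_orbit: "x \<in> orbit G \<phi> x" if "x \<in> carrier G" for x
    using that orbit_refl by simp
  have single: "x \<otimes> u = u \<otimes> x" if x: "x \<in> carrier G" and c: "card (orbit G \<phi> x) = 1" and u: "u \<in> carrier G" for x u
  proof -
    have "u \<otimes> x \<otimes> inv u \<in> orbit G \<phi> x" using x u by (auto simp: orbit_def \<phi>_def)
    hence "u \<otimes> x \<otimes> inv u = x" using c mem_orbit[OF x] by (metis card_1_singletonE singletonD)
    thus ?thesis using x u by (metis inv_solve_right m_closed)
  qed
  have part: "partition (carrier G) (orbits G (carrier G) \<phi>)" by (rule orbit_partition)
  have U: "\<Union> (orbits G (carrier G) \<phi>) = carrier G" using partition.partition_coverture[OF part] .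
  have orb_one: "orbit G \<phi> \<one> = {\<one>}" by (auto simp: orbit_def \<phi>_def intro!: exI[of _ \<one>])
  let ?O = "orbits G (carrier G) \<phi>"
  have finO: "finite ?O" using U fin finite_UnionD by metis
  have order_sum: "order G = (\<Sum>A\<in>?O. card A)"
    using partition.disjoint_sum[OF part fin, of "\<lambda>_. 1::nat"] by (simp add: order_def)
  have oneO: "{\<one>} \<in> ?O" using orb_one unfolding orbits_def by force
  have "\<exists>x\<in>carrier G. x \<noteq> \<one> \<and> card (orbit G \<phi> x) = 1"
  proof (rule ccontr)
    assume neg: "\<not> ?thesis"
    \<comment> \<open>Orbits with more than one element have size divisible by \<open>p\<close>, and
      the orbit of the identity contributes 1; without another fixed point \<open>p\<close> would
      divide 1.\<close>
    have "p dvd card A" if "A \<in> ?O - {{\<one>}}" for A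
    proof -
      obtain x where x: "x \<in> carrier G" "A = orbit G \<phi> x" using \<open>A \<in> ?O - _\<close> by (auto simp: orbits_def)
      hence "x \<noteq> \<one>" using that orb_one by auto
      hence "card A \<noteq> 1" using neg x by auto
      then obtain i where "card A = p ^ i" "i \<noteq> 0" using card_orbit[OF x(1)] x(2) by (metis power_0)
      thus ?thesis by simp
    qed
    hence "p dvd (\<Sum>A\<in>?O - {{\<one>}}. card A)" by (intro dvd_sum)
    moreover have "p dvd order G" using ord k by simp
    moreover have "order G = 1 + (\<Sum>A\<in>?O - {{\<one>}}. card A)"
      using order_sum sum.remove[OF finO oneO, of card] by simp
    ultimately have "p dvd 1" by (metis dvd_add_left_iff)
    thus False using p by simp
  qed
  then obtain x where x: "x \<in> carrier G" "x \<noteq> \<one>" "\<And>u. u \<in> carrier G \<Longrightarrow> x \<otimes> u = u \<otimes> x"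
    using single by blast
  have "x [^] (p ^ k) = \<one>" using pow_order_eq_1[OF x(1)] ord by simp
  define m where "m = (LEAST m. x [^] (p ^ m) = \<one>)"
  have m: "x [^] (p ^ m) = \<one>" unfolding m_def using \<open>x [^] (p ^ k) = \<one>\<close> by (rule LeastI)
  have "m \<noteq> 0" using m x by (metis nat_pow_eone power_0)
  then obtain l where l: "m = Suc l" using not0_implies_Suc by blast
  have "x [^] (p ^ l) \<noteq> \<one>" using not_less_Least[of l "\<lambda>m. x [^] (p ^ m) = \<one>"] l by (simp add: m_def)
  moreover have "(x [^] (p ^ l)) [^] p = \<one>" using m l x by (simp add: nat_pow_pow mult.commute)
  moreover have "x [^] i \<otimes> u = u \<otimes> x [^] i" if "u \<in> carrier G" for u and i :: nat
  proof (induction i)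
    case (Suc i)
    have "x [^] Suc i \<otimes> u = x [^] i \<otimes> (x \<otimes> u)" using x that by (simp add: m_assoc)
    also have "\<dots> = x [^] i \<otimes> u \<otimes> x" using x that by (simp add: m_assoc)
    finally show ?case using x that Suc by (simp add: m_assoc)
  qed (use that in simp)
  ultimately show ?thesis using that[of "x [^] (p ^ l)"] x by blast
qed

context normal
begin

text \<open>The preimage in \<open>G\<close> of the centre of \<open>G Mod H\<close>.\<close>

lemma center_mod_subgroup: "subgroup {z \<in> carrier G. \<forall>u\<in>carrier G. commutator G z u \<in> H} G"
proof -
  have "subgroup {z \<in> carrier G. \<forall>u\<in>carrier G. H #> (z \<otimes> u) = H #> (u \<otimes> z)} G" (is "subgroup ?Z G")
  proof (rule subgroupI)
    show "?Z \<noteq> {}" by (auto intro!: exI[of _ \<one>])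
    show "a \<otimes> b \<in> ?Z" if "a \<in> ?Z" "b \<in> ?Z" for a b
    proof -
      have "H #> (a \<otimes> b \<otimes> u) = H #> (u \<otimes> (a \<otimes> b))" if u: "u \<in> carrier G" for u
      proof -
        have ab: "a \<in> carrier G" "b \<in> carrier G" using \<open>a \<in> ?Z\<close> \<open>b \<in> ?Z\<close> by auto
        have "H #> (a \<otimes> (b \<otimes> u)) = H #> (a \<otimes> (u \<otimes> b))"
          using ab u \<open>b \<in> ?Z\<close> rcos_mult_cong[of a a "b \<otimes> u" "u \<otimes> b"] by simp
        moreover have "H #> (a \<otimes> u \<otimes> b) = H #> (u \<otimes> a \<otimes> b)"
          using ab u \<open>a \<in> ?Z\<close> rcos_mult_cong[of "a \<otimes> u" "u \<otimes> a" b b] by simp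
        ultimately show ?thesis using ab u by (simp add: m_assoc)
      qed
      thus ?thesis using that by auto
    qed
    show "inv a \<in> ?Z" if "a \<in> ?Z" for a
    proof -
      have "H #> (inv a \<otimes> u) = H #> (u \<otimes> inv a)" if u: "u \<in> carrier G" for u
      proof -
        have a: "a \<in> carrier G" using \<open>a \<in> ?Z\<close> by auto
        have "H #> (inv a \<otimes> (u \<otimes> a) \<otimes> inv a) = H #> (inv a \<otimes> (a \<otimes> u) \<otimes> inv a)"
          using a u \<open>a \<in> ?Z\<close> rcos_mult_cong[of "inv a \<otimes> (u \<otimes> a)" "inv a \<otimes> (a \<otimes> u)" "inv a" "inv a"]
            rcos_mult_cong[of "inv a" "inv a" "u \<otimes> a" "a \<otimes> u"] by simp
        thus ?thesis using a u by (simp add: m_assoc)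
      qed
      thus ?thesis using that by auto
    qed
  qed auto
  moreover have "?Z = {z \<in> carrier G. \<forall>u\<in>carrier G. commutator G z u \<in> H}"
    using rcos_commute_iff by blast
  ultimately show ?thesis by simp
qed

text \<open>A conjugate of \<open>h\<close> differs from \<open>h\<close> by an inverse commutator,
  and that lies in \<open>H\<close>.\<close>

lemma normal_of_comm:
  assumes "subgroup Z G" "H \<subseteq> Z" "\<And>z u. z \<in> Z \<Longrightarrow> u \<in> carrier G \<Longrightarrow> commutator G z u \<in> H"
  shows "Z \<lhd> G"
  unfolding normal_inv_iff
proof (intro conjI ballI)
  interpret Z: subgroup Z G by fact
  fix x h assume x: "x \<in> carrier G" and h: "h \<in> Z"
  have "inv (commutator G h x) \<otimes> h \<in> Z" using assms(2) assms(3)[OF h x] h by blast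
  thus "x \<otimes> h \<otimes> inv x \<in> Z"
    using x h by (simp add: inv_mult_group m_assoc)
qed fact

text \<open>The preimage of the elements of order dividing \<open>p\<close> in the centre of
  \<open>G Mod H\<close>; these are closed under products because they commute.\<close>

lemma omega_center_subgroup:
  assumes "prime (p::nat)"
  shows "subgroup {z \<in> carrier G. z [^] p \<in> H \<and> (\<forall>u\<in>carrier G. commutator G z u \<in> H)} G" (is "subgroup ?M G")
proof (rule subgroupI)
  have sH: "subgroup H G" by (rule is_subgroup)
  have "\<one> \<in> ?M" using subgroup.one_closed[OF sH] by simp
  thus "?M \<noteq> {}" by blast
  show "inv a \<in> ?M" if "a \<in> ?M" for a
  proof -
    have "inv (a [^] p) \<in> H" using that subgroup.m_inv_closed[OF sH] by blast
    hence "inv a [^] p \<in> H" using that by (simp add: nat_pow_inv)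
    thus ?thesis using that subgroup.m_inv_closed[OF center_mod_subgroup, of a] by auto
  qed
  show "a \<otimes> b \<in> ?M" if ab: "a \<in> ?M" "b \<in> ?M" for a b
  proof -
    have "commutator G b a \<in> H" using ab by auto
    hence "H #> ((a \<otimes> b) [^] p) = H #> (a [^] p \<otimes> b [^] p)"
      using ab assms commutator_in[of "commutator G b a"] subgroup_int_pow_closed[OF sH, of _ "int p"]
      by (intro pow_prime_mult_mod) (auto simp: int_pow_int)
    moreover have "a [^] p \<otimes> b [^] p \<in> H" using ab subgroup.m_closed[OF sH] by auto
    ultimately have "(a \<otimes> b) [^] p \<in> H"
      using ab rcos_mem_cong[of "(a \<otimes> b) [^] p" "a [^] p \<otimes> b [^] p"] by simp
    thus ?thesis using ab subgroup.m_closed[OF center_mod_subgroup, of a b] by auto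
  qed
qed auto

end

text \<open>Modulo a member \<open>N\<close>, the elements of \<open>A\<close> become central of
  order dividing \<open>p\<close>. In a profinite group the intersection of the family is the closed
  normal subgroup generated by the \<open>p\<close>-th powers of \<open>A\<close> and the
  commutators of \<open>A\<close> with \<open>G\<close>; if \<open>A\<close> is a term of the lower
  \<open>p\<close>-series, this is the next term.\<close>

definition pc_family :: "('a, 'b) monoid_scheme \<Rightarrow> 'a topology \<Rightarrow> nat \<Rightarrow> 'a set \<Rightarrow> 'a set set" where
  "pc_family G T p A = {N. N \<lhd> G \<and> openin T N \<and>
     (\<forall>v\<in>A. v [^]\<^bsub>G\<^esub> p \<in> N \<and> (\<forall>u\<in>carrier G. commutator G v u \<in> N))}"

text \<open>The lower \<open>p\<close>-series again, shifted to start at index \<open>0\<close>; as an intersection of open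
  normal subgroups each term is visibly closed and normal.\<close>

primrec pcs :: "('a, 'b) monoid_scheme \<Rightarrow> 'a topology \<Rightarrow> nat \<Rightarrow> nat \<Rightarrow> 'a set" where
  "pcs G T p 0 = carrier G"
| "pcs G T p (Suc n) = \<Inter> (pc_family G T p (pcs G T p n))"

section \<open>Descent of the lower \<open>p\<close>-series to the identity\<close>

locale pro_p = group G for G :: "('a, 'b) monoid_scheme" (structure) +
  fixes T :: "'a topology" and p :: nat
  assumes prime_p: "prime p" and pro_p: "pro_p_group p G T"
begin

sublocale compact_top_group G T
  using pro_p by unfold_locales (auto simp: pro_p_group_def profinite_group_def)

abbreviation "fam \<equiv> pc_family G T p"
abbreviation "V \<equiv> pcs G T p"

lemma hausdorff: "Hausdorff_space T"
  using pro_p by (auto simp: pro_p_group_def profinite_group_def)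

lemma open_normal_basis:
  assumes "openin T B" "\<one> \<in> B"
  obtains N where "N \<lhd> G" "openin T N" "N \<subseteq> B"
proof -
  obtain H where H: "subgroup H G" "openin T H" "H \<subseteq> B"
    using assms pro_p unfolding pro_p_group_def profinite_group_def by meson
  obtain N where "N \<lhd> G" "openin T N" "N \<subseteq> H" using open_normal_core[OF H(1,2)] by metis
  thus ?thesis using that H by blast
qed

lemma index_power:
  assumes "N \<lhd> G" "openin T N"
  obtains k where "order (G Mod N) = p ^ k"
  using assms pro_p by (auto simp: pro_p_group_def order_def FactGroup_def)

text \<open>Makes every family nonempty, so that the intersections do not degenerate to
  \<open>UNIV\<close>.\<close>

lemma carrier_in_fam: "carrier G \<in> fam (V n)"
  using normal_self openin_topspace[of T] open_subset
proof (induction n)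
  case (Suc n)
  thus ?case by (auto simp: pc_family_def)
qed (auto simp: pc_family_def)

lemma V_subset: "V n \<subseteq> carrier G"
  using carrier_in_fam by (cases n) auto

lemma V_carrier: "x \<in> V n \<Longrightarrow> x \<in> carrier G"
  using V_subset by blast

lemma V_normal: "V n \<lhd> G"
proof (cases n)
  case (Suc m)
  have "subgroup (\<Inter> (fam (V m))) G"
    using carrier_in_fam[of m] by (intro subgroups_Inter) (auto simp: pc_family_def normal_imp_subgroup)
  moreover have "x \<otimes> h \<otimes> inv x \<in> N" if "x \<in> carrier G" "h \<in> \<Inter> (fam (V m))" "N \<in> fam (V m)" for x h N
    using that normal.inv_op_closed2[of N G x h] by (auto simp: pc_family_def)
  ultimately show ?thesis unfolding normal_inv_iff Suc by auto
qed (simp add: normal_self)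

lemma V_subgroup: "subgroup (V n) G"
  using V_normal normal_imp_subgroup by blast

lemma V_pow: "v \<in> V n \<Longrightarrow> v [^] p \<in> V (Suc n)"
  and V_comm: "v \<in> V n \<Longrightarrow> u \<in> carrier G \<Longrightarrow> commutator G v u \<in> V (Suc n)"
  by (auto simp: pc_family_def)

lemma V_least: "N \<in> fam (V n) \<Longrightarrow> V (Suc n) \<subseteq> N"
  by auto

lemma fam_step:
  assumes "N \<lhd> G" "openin T N" "A \<subseteq> N" shows "N \<in> fam A"
proof -
  interpret normal N G by fact
  show ?thesis
    using assms commutator_in subgroup_int_pow_closed[OF is_subgroup, of _ "int p"]
    by (auto simp: pc_family_def int_pow_int)
qed

text \<open>Each member of \<open>fam (V m)\<close> contains \<open>V (Suc m)\<close> and hence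
  belongs to the next family too; intersecting a larger family gives a smaller set.\<close>

lemma V_decr: "V (Suc n) \<subseteq> V n"
proof (cases n)
  case (Suc m)
  have "N \<in> fam (V (Suc m))" if "N \<in> fam (V m)" for N
    using V_least[OF that] that by (intro fam_step) (auto simp: pc_family_def)
  thus ?thesis unfolding Suc by auto
qed (use V_subset[of "Suc 0"] in simp)

lemma V_mono: "m \<le> n \<Longrightarrow> V n \<subseteq> V m"
  by (rule lift_Suc_antimono_le[of V]) (use V_decr in auto)

lemma V_rcos_mono:
  assumes "V m #> a = V m #> b" "n \<le> m" "a \<in> carrier G" "b \<in> carrier G"
  shows "V n #> a = V n #> b"
  using assms V_mono[OF assms(2)] normal.rcos_eq_iff[OF V_normal] by blast

lemma V_conj: "v \<in> V n \<Longrightarrow> u \<in> carrier G \<Longrightarrow> u \<otimes> v \<otimes> inv u \<in> V n"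
  using normal.inv_op_closed2[OF V_normal, of u v n] by simp

lemma V_inv: "v \<in> V n \<Longrightarrow> inv v \<in> V n"
  using subgroup.m_inv_closed[OF V_subgroup] by simp

lemma V_mult: "v \<in> V n \<Longrightarrow> w \<in> V n \<Longrightarrow> v \<otimes> w \<in> V n"
  using subgroup.m_closed[OF V_subgroup] by simp

lemma V_pow_iter: "v \<in> V k \<Longrightarrow> v [^] (p ^ n) \<in> V (k + n)"
proof (induction n)
  case (Suc n)
  have "v [^] (p ^ Suc n) = (v [^] (p ^ n)) [^] p"
    using V_carrier[OF Suc.prems] by (simp add: nat_pow_pow mult.commute)
  thus ?case using V_pow[OF Suc.IH[OF Suc.prems]] by simp
qed (use V_carrier in simp)

text \<open>\<open>G Mod N\<close> is a nontrivial \<open>p\<close>-group, so its centre has an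
  element of order \<open>p\<close>, and \<open>M\<close> is the preimage of all central elements of
  order dividing \<open>p\<close>. The conclusion \<open>N \<in> fam M\<close> means that a term of
  the series inside \<open>M\<close> forces the next term into \<open>N\<close>.\<close>

lemma central_extension:
  assumes N: "N \<lhd> G" "openin T N" "N \<noteq> carrier G"
  obtains M where "M \<lhd> G" "openin T M" "N \<subset> M" "N \<in> fam M"
proof -
  interpret normal N G by fact
  define M where "M = {z \<in> carrier G. z [^] p \<in> N \<and> (\<forall>u\<in>carrier G. commutator G z u \<in> N)}"
  have sM: "subgroup M G" unfolding M_def by (rule omega_center_subgroup[OF prime_p])
  have NM: "N \<subseteq> M"
    using commutator_in subgroup_int_pow_closed[OF is_subgroup, of _ "int p"]
    by (auto simp: M_def int_pow_int)
  have nM: "M \<lhd> G" by (rule normal_of_comm[OF sM NM]) (auto simp: M_def)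
  have oM: "openin T M" by (rule open_subgroup_mono[OF is_subgroup N(2) sM NM])
  interpret Q: group "G Mod N" by (rule factorgroup_is_group)
  obtain k where k: "order (G Mod N) = p ^ k" using index_power[OF N(1,2)] .
  have "k \<noteq> 0"
  proof
    assume "k = 0"
    hence "carrier (G Mod N) = {\<one>\<^bsub>G Mod N\<^esub>}" using k Q.order_one_triv_iff by simp
    hence "\<forall>x\<in>carrier G. N #> x = N" by (auto simp: carrier_FactGroup)
    hence "carrier G \<subseteq> N" using rcos_eq_self_iff by blast
    thus False using N subset by blast
  qed
  then obtain z where z: "z \<in> carrier (G Mod N)" "z \<noteq> \<one>\<^bsub>G Mod N\<^esub>" "z [^]\<^bsub>G Mod N\<^esub> p = \<one>\<^bsub>G Mod N\<^esub>"
    "\<And>u. u \<in> carrier (G Mod N) \<Longrightarrow> z \<otimes>\<^bsub>G Mod N\<^esub> u = u \<otimes>\<^bsub>G Mod N\<^esub> z"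
    using Q.p_group_central_element[OF prime_p k] by blast
  obtain x where x: "x \<in> carrier G" "z = N #> x" using z(1) by (auto simp: carrier_FactGroup)
  have xp: "x [^] p \<in> N" using z(3) x FactGroup_pow[of x p] rcos_eq_self_iff[of "x [^] p"] by simp
  have "commutator G x u \<in> N" if "u \<in> carrier G" for u
  proof -
    have "N #> u \<in> carrier (G Mod N)" using that by (simp add: carrier_FactGroup)
    hence "(N #> x) <#> (N #> u) = (N #> u) <#> (N #> x)" using z(4) x(2) by simp
    thus ?thesis using x that rcos_commute_iff[OF x(1) that] by (simp only: rcos_sum)
  qed
  hence "x \<in> M" using xp x(1) by (simp add: M_def)
  moreover have "x \<notin> N" using z(2) x rcos_eq_self_iff by auto
  ultimately have "N \<subset> M" using NM by blast
  moreover have "N \<in> fam M" using N by (auto simp: pc_family_def M_def)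
  ultimately show ?thesis using that nM oM by blast
qed

text \<open>Climb from \<open>N\<close> to \<open>G\<close> by \<open>central_extension\<close>; on
  the way back each step of the climb costs one index of the series, since
  \<open>V k \<subseteq> L\<close> and \<open>M \<in> fam L\<close> give
  \<open>V (Suc k) \<subseteq> M\<close>.\<close>

lemma V_basis:
  assumes "N \<lhd> G" "openin T N"
  obtains n where "V n \<subseteq> N"
proof -
  obtain F where F: "finite F" "F \<subseteq> carrier G" "carrier G \<subseteq> N <#> F"
    using open_subgroup_finite_index[OF normal_imp_subgroup[OF assms(1)] assms(2)] .
  have "\<exists>n. V n \<subseteq> M" if "M \<lhd> G" "openin T M" "N \<subseteq> M" for M
    using that
  \<comment> \<open>The climb terminates because every strictly larger subgroup above
    \<open>N\<close> swallows another representative of a coset of \<open>N\<close>.\<close>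
  proof (induction "card (F - M)" arbitrary: M rule: less_induct)
    case less
    show ?case
    proof (cases "M = carrier G")
      case False
      then obtain L where L: "L \<lhd> G" "openin T L" "M \<subset> L" "M \<in> fam L"
        using central_extension[OF less.prems(1,2)] by blast
      interpret M: subgroup M G using less.prems normal_imp_subgroup by blast
      interpret L: subgroup L G using L normal_imp_subgroup by blast
      obtain x where x: "x \<in> L" "x \<notin> M" using L by blast
      then obtain n f where nf: "n \<in> N" "f \<in> F" "x = n \<otimes> f" using F L.subset unfolding set_mult_def by blast
      have n: "n \<in> M" "n \<in> L" using nf less.prems L by auto
      have fc: "f \<in> carrier G" using nf F by auto
      have "f = inv n \<otimes> x" using nf n fc by simp
      hence "f \<in> L" using n x by simp
      moreover have "f \<notin> M" using x nf n by auto
      ultimately have "F - L \<subset> F - M" using nf L by auto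
      hence "card (F - L) < card (F - M)" using F by (intro psubset_card_mono) auto
      then obtain k where "V k \<subseteq> L" using less.hyps[of L] L less.prems by auto
      hence "M \<in> fam (V k)" using L by (auto simp: pc_family_def)
      thus ?thesis using V_least by blast
    qed (use V_subset[of 0] in blast)
  qed
  thus ?thesis using assms that by blast
qed

lemma V_Inter:
  assumes "\<And>n. x \<in> V n" shows "x = \<one>"
proof (rule ccontr)
  assume "x \<noteq> \<one>"
  moreover have "x \<in> carrier G" using assms[of 0] by simp
  ultimately obtain B where "openin T B" "\<one> \<in> B" "x \<notin> B"
    using hausdorff unfolding Hausdorff_space_def by (metis disjnt_iff one_closed topspace)
  then obtain N where "N \<lhd> G" "openin T N" "N \<subseteq> B" using open_normal_basis by metis
  thus False using V_basis assms \<open>x \<notin> B\<close> by blast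
qed

end

section \<open>Uniformly powerful groups\<close>

locale uniform = pro_p +
  assumes fin_gen: "\<exists>S. finite S \<and> topologically_generates G T S"
    and powerful: "powerful p G T"
    and torsion_free: "torsion_free G"
begin

text \<open>An open subgroup is closed, so it contains the closure in the definition of
  \<open>powerful\<close> as soon as it contains the \<open>p\<close>-th powers, or the fourth
  powers if \<open>p = 2\<close>.\<close>

lemma powerful_in:
  assumes W: "subgroup W G" "openin T W" and "\<And>x. p \<noteq> 2 \<Longrightarrow> x \<in> carrier G \<Longrightarrow> x [^] p \<in> W"
    and x: "x \<in> carrier G" "y \<in> carrier G"
    and "\<And>x. p = 2 \<Longrightarrow> x \<in> carrier G \<Longrightarrow> x [^] (4::nat) \<in> W"
  shows "commutator G x y \<in> W"
proof -
  have "power_subgroup G (carrier G) (if p = 2 then 4 else p) \<subseteq> W"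
    unfolding power_subgroup_def using assms by (intro generate_subgroup_incl) auto
  hence "T closure_of power_subgroup G (carrier G) (if p = 2 then 4 else p) \<subseteq> W"
    by (intro closure_subset_open_subgroup W)
  moreover have "commutator G x y \<in> commutator_subgroup G (carrier G) (carrier G)"
    unfolding commutator_subgroup_def using x by (intro generate.incl) blast
  ultimately show ?thesis using powerful unfolding powerful_def by blast
qed

lemma pc_familyD:
  assumes "N \<in> fam A"
  shows "N \<lhd> G" "openin T N" "subgroup N G" "\<And>v. v \<in> A \<Longrightarrow> v [^] p \<in> N"
    "\<And>v u. v \<in> A \<Longrightarrow> u \<in> carrier G \<Longrightarrow> commutator G v u \<in> N"
  using assms by (auto simp: pc_family_def normal_imp_subgroup)

lemma pow_four: "x \<in> carrier G \<Longrightarrow> p = 2 \<Longrightarrow> x [^] (4::nat) = (x [^] p) [^] p"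
  by (simp add: nat_pow_pow)

text \<open>For \<open>p = 2\<close> commutators drop two levels instead of one; this supplies the
  extra hypothesis of \<open>pow_prime_mult\<close>. At the top level it is powerfulness, as fourth
  powers are squares of squares.\<close>

lemma V_comm_two:
  assumes "p = 2"
  shows "v \<in> V n \<Longrightarrow> u \<in> carrier G \<Longrightarrow> commutator G v u \<in> V (Suc (Suc n))"
proof (induction n arbitrary: v u)
  case 0
  have "commutator G v u \<in> N" if N: "N \<in> fam (V (Suc 0))" for N
  proof (rule powerful_in)
    show "x [^] (4::nat) \<in> N" if "x \<in> carrier G" for x
      using pc_familyD(4)[OF N V_pow[of x 0]] that assms pow_four by simp
  qed (use pc_familyD[OF N] 0 assms in simp_all)
  thus ?case by simp
next
  case (Suc n)
  have "commutator G v u \<in> N" if N: "N \<in> fam (V (Suc (Suc n)))" for N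
  proof -
    interpret normal N G using pc_familyD(1)[OF N] .
    \<comment> \<open>\<open>Z\<close> is the preimage of the centre of \<open>G Mod N\<close>. The
      goal is \<open>V (Suc n) \<subseteq> Z\<close>, which follows once \<open>Z\<close> belongs to
      \<open>fam (V n)\<close>.\<close>
    define Z where "Z = {z \<in> carrier G. \<forall>u\<in>carrier G. commutator G z u \<in> N}"
    have sZ: "subgroup Z G" unfolding Z_def by (rule center_mod_subgroup)
    have NZ: "N \<subseteq> Z" using commutator_in by (auto simp: Z_def)
    have nZ: "Z \<lhd> G" by (rule normal_of_comm[OF sZ NZ]) (auto simp: Z_def)
    have oZ: "openin T Z" by (rule open_subgroup_mono[OF is_subgroup pc_familyD(2)[OF N] sZ NZ])
    have "commutator G v u \<in> Z" if v: "v \<in> V n" and u: "u \<in> carrier G" for v u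
      using pc_familyD(5)[OF N Suc.IH[OF v u]] V_carrier[OF v] u by (simp add: Z_def)
    moreover have "v [^] p \<in> Z" if v: "v \<in> V n" for v
    proof -
      have vc: "v \<in> carrier G" using V_carrier[OF v] .
      have "commutator G (v [^] p) u \<in> N" if u: "u \<in> carrier G" for u
      proof -
        define w where "w = commutator G v u"
        have w: "w \<in> V (Suc (Suc n))" unfolding w_def by (rule Suc.IH[OF v u])
        have wc: "w \<in> carrier G" using vc u by (simp add: w_def)
        have "w \<otimes> w \<in> N" using pc_familyD(4)[OF N w] assms wc by (simp add: numeral_2_eq_2)
        \<comment> \<open>Moving \<open>u\<close> past both copies of \<open>v\<close> produces
          \<open>w\<close> twice, and \<open>w \<otimes> w\<close> lies in \<open>N\<close> because
          \<open>w\<close> lies in \<open>V (Suc (Suc n))\<close>.\<close>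
        have "v [^] p \<otimes> u = v \<otimes> (v \<otimes> u)" using assms vc u by (simp add: numeral_2_eq_2 m_assoc)
        also have "v \<otimes> u = w \<otimes> u \<otimes> v" using commutator_mult[OF vc u] by (simp add: w_def)
        also have "v \<otimes> (w \<otimes> u \<otimes> v) = (v \<otimes> w) \<otimes> (u \<otimes> v)" using vc u wc by (simp add: m_assoc)
        finally have 1: "v [^] p \<otimes> u = (v \<otimes> w) \<otimes> (u \<otimes> v)" .
        have "N #> (v \<otimes> w) = N #> (w \<otimes> v)"
          using rcos_commute_iff[OF wc vc] pc_familyD(5)[OF N w vc] by simp
        hence "N #> (v [^] p \<otimes> u) = N #> ((w \<otimes> v) \<otimes> (u \<otimes> v))"
          unfolding 1 using vc u wc rcos_mult_cong[of "v \<otimes> w" "w \<otimes> v" "u \<otimes> v" "u \<otimes> v"] by simp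
        also have "(w \<otimes> v) \<otimes> (u \<otimes> v) = w \<otimes> (v \<otimes> u) \<otimes> v" using vc u wc by (simp add: m_assoc)
        also have "\<dots> = w \<otimes> (w \<otimes> u \<otimes> v) \<otimes> v" using commutator_mult[OF vc u] by (simp add: w_def)
        also have "\<dots> = (w \<otimes> w) \<otimes> (u \<otimes> v [^] p)"
          using vc u wc assms by (simp add: numeral_2_eq_2 m_assoc)
        also have "N #> \<dots> = N #> (u \<otimes> v [^] p)"
        proof -
          have "N #> (w \<otimes> w) = N #> \<one>" using rcos_eq_self_iff[of "w \<otimes> w"] \<open>w \<otimes> w \<in> N\<close> wc subset by simp
          hence "N #> ((w \<otimes> w) \<otimes> (u \<otimes> v [^] p)) = N #> (\<one> \<otimes> (u \<otimes> v [^] p))"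
            using vc u wc by (intro rcos_mult_cong) auto
          thus ?thesis using vc u by simp
        qed
        finally show ?thesis using rcos_commute_iff vc u by simp
      qed
      thus ?thesis using vc by (simp add: Z_def)
    qed
    ultimately have "Z \<in> fam (V n)" using nZ oZ by (auto simp: pc_family_def)
    hence "v \<in> Z" using Suc.prems V_least by blast
    thus ?thesis using Suc.prems by (simp add: Z_def)
  qed
  thus ?case by simp
qed

text \<open>The commutator \<open>w\<close> of \<open>z\<close> and \<open>x\<close> lies one level
  below \<open>z\<close>, so its \<open>p\<close>-th power and its commutators lie two levels below,
  and for \<open>p = 2\<close> so does \<open>w\<close> itself. Only \<open>z\<close> is tied to a
  level; \<open>x\<close> is arbitrary.\<close>

lemma V_pow_mult:
  assumes x: "x \<in> carrier G" and z: "z \<in> V n"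
  shows "V (Suc (Suc n)) #> ((x \<otimes> z) [^] p) = V (Suc (Suc n)) #> (x [^] p \<otimes> z [^] p)"
proof -
  interpret normal "V (Suc (Suc n))" G by (rule V_normal)
  have zc: "z \<in> carrier G" using z V_carrier by blast
  have w: "commutator G z x \<in> V (Suc n)" using V_comm z x by blast
  show ?thesis
    using V_comm[OF w x] V_comm[OF w zc] V_pow[OF w] V_comm_two[OF _ z x]
    by (intro pow_prime_mult_mod prime_p x zc)
qed

lemma V_pow_cong:
  assumes a: "a \<in> carrier G" "b \<in> carrier G" and ab: "V (Suc n) #> a = V (Suc n) #> b"
  shows "V (Suc (Suc n)) #> (a [^] p) = V (Suc (Suc n)) #> (b [^] p)"
proof -
  interpret A: normal "V (Suc n)" G by (rule V_normal)
  interpret B: normal "V (Suc (Suc n))" G by (rule V_normal)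
  define t where "t = inv b \<otimes> a"
  have "a \<otimes> inv b \<in> V (Suc n)" using A.rcos_eq_iff[OF a] ab by simp
  hence "inv b \<otimes> (a \<otimes> inv b) \<otimes> inv (inv b) \<in> V (Suc n)" using a by (intro V_conj) auto
  hence t: "t \<in> V (Suc n)" using a by (simp add: t_def m_assoc)
  have a': "a = b \<otimes> t" using a by (simp add: t_def)
  have tp: "t [^] p \<in> V (Suc (Suc n))" using V_pow[OF t] .
  have tc: "t \<in> carrier G" using a by (simp add: t_def)
  have "V (Suc (Suc n)) #> (a [^] p) = V (Suc (Suc n)) #> (b [^] p \<otimes> t [^] p)"
    \<comment> \<open>\<open>t\<close> is used as an element of the larger \<open>V n\<close>, which
      gives exactly the required modulus.\<close>
    unfolding a' using t V_decr by (intro V_pow_mult a) blast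
  also have "\<dots> = V (Suc (Suc n)) #> (b [^] p \<otimes> \<one>)"
    using tp tc a B.rcos_eq_self_iff[of "t [^] p"] B.rcos_eq_self_iff[of \<one>]
      B.rcos_mult_cong[of "b [^] p" "b [^] p" "t [^] p" \<one>] B.one_closed by simp
  finally show ?thesis using a by simp
qed

section \<open>Surjectivity of the power maps between consecutive factors\<close>

definition pow_onto :: "nat \<Rightarrow> 'a set \<Rightarrow> bool" where
  "pow_onto n N \<longleftrightarrow> (\<forall>v\<in>V (Suc n). \<exists>y\<in>V n. N #> v = N #> (y [^] p))"

text \<open>The modulus is a member \<open>N\<close> of the family because
  \<open>V (Suc (Suc n))\<close> is not yet known to be open. The set \<open>W\<close> of elements
  congruent to \<open>p\<close>-th powers from \<open>V n\<close> is an open normal subgroup; it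
  contains \<open>V (Suc n)\<close> as soon as it belongs to \<open>fam (V n)\<close>.\<close>

lemma pow_onto_fam:
  assumes N: "N \<in> fam (V (Suc n))" and IH: "\<And>m. n = Suc m \<Longrightarrow> pow_onto m (V (Suc n))"
  shows "pow_onto n N"
proof -
  interpret normal N G using pc_familyD(1)[OF N] .
  have VN: "V (Suc (Suc n)) \<subseteq> N" by (rule V_least[OF N])
  have up: "N #> a = N #> b" if "V (Suc (Suc n)) #> a = V (Suc (Suc n)) #> b" "a \<in> carrier G" "b \<in> carrier G" for a b
    using normal.rcos_eq_iff[OF V_normal, of a b "Suc (Suc n)"] rcos_eq_iff[of a b] that VN by blast
  define W where "W = {x \<in> carrier G. \<exists>y\<in>V n. N #> x = N #> (y [^] p)}"
  have mult: "N #> ((x \<otimes> y) [^] p) = N #> (x [^] p \<otimes> y [^] p)" if "x \<in> V n" "y \<in> V n" for x y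
    using V_pow_mult[of x y n] that V_carrier by (intro up) auto
  have sW: "subgroup W G"
  proof (rule subgroupI)
    have "\<one> \<in> V n" by (rule subgroup.one_closed[OF V_subgroup])
    hence "\<one> \<in> W" unfolding W_def by (auto intro!: bexI[of _ \<one>])
    thus "W \<noteq> {}" by blast
    show "inv a \<in> W" if "a \<in> W" for a
    proof -
      obtain y where y: "y \<in> V n" "N #> a = N #> (y [^] p)" "a \<in> carrier G" using \<open>a \<in> W\<close> unfolding W_def by blast
      have yc: "y \<in> carrier G" using y V_carrier by blast
      have "N #> inv a = N #> (inv y [^] p)" using rcos_inv_cong[OF y(3) _ y(2)] yc by (simp add: nat_pow_inv)
      thus ?thesis using y V_inv by (auto simp: W_def)
    qed
    show "a \<otimes> b \<in> W" if ab: "a \<in> W" "b \<in> W" for a b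
    proof -
      obtain y where y: "y \<in> V n" "N #> a = N #> (y [^] p)" "a \<in> carrier G" using ab by (auto simp: W_def)
      obtain z where z: "z \<in> V n" "N #> b = N #> (z [^] p)" "b \<in> carrier G" using ab by (auto simp: W_def)
      have "N #> (a \<otimes> b) = N #> (y [^] p \<otimes> z [^] p)"
        using y z V_carrier by (intro rcos_mult_cong) auto
      also have "\<dots> = N #> ((y \<otimes> z) [^] p)" using mult y z by simp
      finally show ?thesis using y z V_mult by (auto simp: W_def)
    qed
  qed (auto simp: W_def)
  have NW: "N \<subseteq> W"
  proof
    fix x assume "x \<in> N"
    hence "x \<in> carrier G" "N #> x = N #> (\<one> [^] p)" using rcos_eq_self_iff[of x] subset by auto
    thus "x \<in> W" using subgroup.one_closed[OF V_subgroup, of n] unfolding W_def by blast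
  qed
  have pW: "y [^] p \<in> W" if "y \<in> V n" for y using that V_carrier by (auto simp: W_def)
  have nW: "W \<lhd> G" unfolding normal_inv_iff
  proof (intro conjI ballI sW)
    fix x h assume x: "x \<in> carrier G" and h: "h \<in> W"
    obtain y where y: "y \<in> V n" "N #> h = N #> (y [^] p)" "h \<in> carrier G" using h by (auto simp: W_def)
    have yc: "y \<in> carrier G" using y V_carrier by blast
    have conj_pow: "(x \<otimes> y \<otimes> inv x) [^] k = x \<otimes> y [^] k \<otimes> inv x" for k :: nat
      using x yc by (induction k) (simp_all add: m_assoc)
    have "N #> (x \<otimes> h) = N #> (x \<otimes> y [^] p)" using x y yc by (intro rcos_mult_cong) auto
    hence "N #> (x \<otimes> h \<otimes> inv x) = N #> (x \<otimes> y [^] p \<otimes> inv x)" using x y yc by (intro rcos_mult_cong) auto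
    hence "N #> (x \<otimes> h \<otimes> inv x) = N #> ((x \<otimes> y \<otimes> inv x) [^] p)" by (simp only: conj_pow)
    thus "x \<otimes> h \<otimes> inv x \<in> W" using x y V_conj by (auto simp: W_def)
  qed
  have oW: "openin T W" by (rule open_subgroup_mono[OF is_subgroup pc_familyD(2)[OF N] sW NW])
  \<comment> \<open>At the top level this is powerfulness. Further down,
    \<open>v = t \<otimes> y [^] p\<close> with \<open>t\<close> central modulo \<open>N\<close>;
    conjugation by \<open>u\<close> replaces \<open>y\<close> by \<open>y \<otimes> w\<close> with
    \<open>w \<in> V n\<close>, so the conjugate of \<open>v\<close> is congruent to
    \<open>v \<otimes> w [^] p\<close> and the commutator to a \<open>p\<close>-th power of
    \<open>inv w\<close>.\<close>
  have "commutator G v u \<in> W" if v: "v \<in> V n" and u: "u \<in> carrier G" for v u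
  proof (cases n)
    case 0
    show ?thesis
      using pW 0 v u by (intro powerful_in sW oW) (auto simp: pow_four)
  next
    case (Suc m)
    have vc: "v \<in> carrier G" using V_carrier[OF v] .
    obtain y where y: "y \<in> V m" "V (Suc n) #> v = V (Suc n) #> (y [^] p)"
      using IH[OF Suc] v unfolding pow_onto_def Suc by blast
    have yc: "y \<in> carrier G" using V_carrier[OF y(1)] .
    define t where "t = v \<otimes> inv (y [^] p)"
    have t: "t \<in> V (Suc n)" using normal.rcos_eq_iff[OF V_normal, of v "y [^] p" "Suc n"] y(2) vc yc by (simp add: t_def del: pcs.simps)
    have tc: "t \<in> carrier G" using V_carrier[OF t] .
    have v': "v = t \<otimes> y [^] p" using vc yc by (simp add: t_def m_assoc)
    \<comment> \<open>Starting from \<open>inv y\<close> makes the conjugate of \<open>y\<close> by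
      \<open>u\<close> equal to \<open>y \<otimes> w\<close>.\<close>
    define w where "w = commutator G (inv y) u"
    have w: "w \<in> V n" unfolding w_def Suc using V_comm[OF V_inv[OF y(1)] u] .
    have wc: "w \<in> carrier G" using V_carrier[OF w] .
    have wp: "w [^] p \<in> V (Suc n)" using V_pow[OF w] .
    have conj_pow: "(u \<otimes> y \<otimes> inv u) [^] k = u \<otimes> y [^] k \<otimes> inv u" for k :: nat
      using u yc by (induction k) (simp_all add: m_assoc)
    have "u \<otimes> v \<otimes> inv u = (u \<otimes> t \<otimes> inv u) \<otimes> (u \<otimes> y \<otimes> inv u) [^] p"
      unfolding conj_pow v' using u tc yc by (simp add: m_assoc)
    also have "u \<otimes> y \<otimes> inv u = y \<otimes> w" using u yc by (simp add: w_def m_assoc)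
    finally have e: "u \<otimes> v \<otimes> inv u = (u \<otimes> t \<otimes> inv u) \<otimes> (y \<otimes> w) [^] p" .
    have 1: "N #> (u \<otimes> t \<otimes> inv u) = N #> t"
    proof -
      have "commutator G t u \<in> N" using pc_familyD(5)[OF N t u] .
      hence "inv (commutator G t u) \<in> N" using subgroup.m_inv_closed[OF is_subgroup] by blast
      hence "u \<otimes> t \<otimes> inv u \<otimes> inv t \<in> N" using u tc by (simp add: inv_mult_group m_assoc)
      thus ?thesis using rcos_eq_iff u tc by simp
    qed
    have 2: "N #> ((y \<otimes> w) [^] p) = N #> (y [^] p \<otimes> w [^] p)"
      using V_pow_mult[OF yc w] yc wc by (intro up) auto
    have "N #> (u \<otimes> v \<otimes> inv u) = N #> (t \<otimes> (y [^] p \<otimes> w [^] p))"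
      unfolding e using 1 2 u tc yc wc by (intro rcos_mult_cong) auto
    hence "N #> (u \<otimes> v \<otimes> inv u) = N #> (v \<otimes> w [^] p)"
      using v' tc yc wc by (simp add: m_assoc)
    also have "\<dots> = N #> (w [^] p \<otimes> v)"
      using rcos_commute_iff[of "w [^] p" v] pc_familyD(5)[OF N wp vc] wc vc by simp
    finally have "N #> (v \<otimes> inv (u \<otimes> v \<otimes> inv u)) = N #> (v \<otimes> inv (w [^] p \<otimes> v))"
      using vc u wc rcos_inv_cong[of "u \<otimes> v \<otimes> inv u" "w [^] p \<otimes> v"]
        rcos_mult_cong[of v v "inv (u \<otimes> v \<otimes> inv u)" "inv (w [^] p \<otimes> v)"] by simp
    hence "N #> commutator G v u = N #> (inv w [^] p)"
      using vc u wc by (simp add: inv_mult_group m_assoc nat_pow_inv)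
    thus ?thesis using V_inv[OF w] vc u by (auto simp: W_def)
  qed
  hence "W \<in> fam (V n)" using pW nW oW by (auto simp: pc_family_def)
  hence "V (Suc n) \<subseteq> W" by (rule V_least)
  thus ?thesis by (auto simp: pow_onto_def W_def)
qed

end

declare pcs.simps(2) [simp del]

section \<open>Openness of the terms of the series\<close>

context pro_p
begin

lemma fam_Int:
  assumes "M \<in> fam A" "N \<in> fam A" shows "M \<inter> N \<in> fam A"
  using assms normal_subgroup_intersect[of M N] by (auto simp: pc_family_def)

lemma fam_INT:
  assumes "finite I" "\<And>i. i \<in> I \<Longrightarrow> f i \<in> fam (V n)"
  shows "\<exists>N\<in>fam (V n). \<forall>i\<in>I. N \<subseteq> f i"
  using assms
proof (induction I rule: finite_induct)
  case (insert i I)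
  then obtain N where "N \<in> fam (V n)" "\<forall>i\<in>I. N \<subseteq> f i" by auto
  thus ?case using fam_Int[of N "V n" "f i"] insert.prems by blast
qed (use carrier_in_fam in auto)

text \<open>One \<open>F\<close> serves all members of the family, so finitely many cosets of
  \<open>V (Suc n)\<close> cover \<open>V n\<close>. A single member chosen to avoid the finitely
  many elements of \<open>F\<close> outside \<open>V (Suc n)\<close> then meets \<open>V n\<close>
  inside \<open>V (Suc n)\<close>.\<close>

lemma V_open_of_cover:
  assumes o: "openin T (V n)" and F: "finite F" "F \<subseteq> carrier G"
    and cov: "\<And>N. N \<in> fam (V n) \<Longrightarrow> V n \<subseteq> N <#> F"
  shows "openin T (V (Suc n))"
proof -
  let ?W = "V (Suc n)"
  have W: "?W = \<Inter> (fam (V n))" by (simp add: pcs.simps)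
  interpret W: subgroup ?W G by (rule V_subgroup)
  \<comment> \<open>Compactness in disguise: the family is directed and \<open>F\<close> is finite.\<close>
  have cover: "V n \<subseteq> ?W <#> F"
  proof
    fix v assume v: "v \<in> V n"
    show "v \<in> ?W <#> F"
    proof (rule ccontr)
      assume neg: "v \<notin> ?W <#> F"
      have "\<exists>N\<in>fam (V n). v \<otimes> inv f \<notin> N" if f: "f \<in> F" for f
      proof (rule ccontr)
        assume "\<not> ?thesis"
        hence "v \<otimes> inv f \<in> ?W" by (auto simp: W)
        hence "v \<otimes> inv f \<otimes> f \<in> ?W <#> F" using f unfolding set_mult_def by blast
        thus False using neg f F V_carrier[OF v] by (auto simp: m_assoc)
      qed
      then obtain \<nu> where \<nu>: "\<And>f. f \<in> F \<Longrightarrow> \<nu> f \<in> fam (V n) \<and> v \<otimes> inv f \<notin> \<nu> f" by metis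
      then obtain N where N: "N \<in> fam (V n)" "\<forall>f\<in>F. N \<subseteq> \<nu> f" using fam_INT[OF F(1), of \<nu>] by metis
      obtain h f where hf: "h \<in> N" "f \<in> F" "v = h \<otimes> f" using cov[OF N(1)] v unfolding set_mult_def by blast
      have "h \<in> carrier G" using hf N by (auto simp: pc_family_def dest: normal_imp_subgroup subgroup.mem_carrier)
      hence "v \<otimes> inv f = h" using hf F by (auto simp: m_assoc)
      thus False using hf N \<nu> by blast
    qed
  qed
  have "\<exists>N\<in>fam (V n). f \<notin> N" if "f \<in> F - ?W" for f using that by (auto simp: W)
  then obtain \<nu> where \<nu>: "\<And>f. f \<in> F - ?W \<Longrightarrow> \<nu> f \<in> fam (V n) \<and> f \<notin> \<nu> f" by metis
  then obtain N where N: "N \<in> fam (V n)" "\<forall>f\<in>F - ?W. N \<subseteq> \<nu> f" using fam_INT[of "F - ?W" \<nu> n] F(1) by blast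
  have sN: "subgroup N G" using N by (simp add: pc_family_def normal_imp_subgroup)
  have "N \<inter> V n \<subseteq> ?W"
  proof
    fix x assume x: "x \<in> N \<inter> V n"
    then obtain h f where hf: "h \<in> ?W" "f \<in> F" "x = h \<otimes> f" using cover unfolding set_mult_def by blast
    have hN: "h \<in> N" using hf N by (auto simp: W)
    have fc: "f \<in> carrier G" "h \<in> carrier G" using hf F by auto
    have "f = inv h \<otimes> x" using hf fc by simp
    hence "f \<in> N" using hN x subgroup.m_closed[OF sN subgroup.m_inv_closed[OF sN]] by auto
    hence "f \<in> ?W" using N \<nu> hf by blast
    thus "x \<in> ?W" using hf by simp
  qed
  moreover have "openin T (N \<inter> V n)" using N o by (auto simp: pc_family_def)
  moreover have "subgroup (N \<inter> V n) G" using subgroups_Inter_pair[OF sN V_subgroup] .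
  ultimately show ?thesis using open_subgroup_mono W.subgroup_axioms by blast
qed

text \<open>Modulo \<open>N\<close> the group is elementary abelian, so products of the generators
  with exponents below \<open>p\<close> represent the whole generated subgroup. These products are
  independent of \<open>N\<close>, as \<open>V_open_of_cover\<close> demands.\<close>

lemma finite_cover_generate:
  assumes "finite S" "S \<subseteq> carrier G"
  shows "\<exists>F. finite F \<and> F \<subseteq> carrier G \<and> (\<forall>N\<in>fam (carrier G). generate G S \<subseteq> N <#> F)"
  using assms
proof (induction S rule: finite_induct)
  case empty
  have "generate G {} \<subseteq> N <#> {\<one>}" if "N \<in> fam (carrier G)" for N
  proof -
    have "\<one> \<in> N" using that by (auto simp: pc_family_def dest: normal_imp_subgroup subgroup.one_closed)
    hence "\<one> \<otimes> \<one> \<in> N <#> {\<one>}" unfolding set_mult_def by blast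
    thus ?thesis by (simp add: generate_empty)
  qed
  thus ?case by (intro exI[of _ "{\<one>}"]) auto
next
  case (insert s S)
  then obtain F where F: "finite F" "F \<subseteq> carrier G" "\<And>N. N \<in> fam (carrier G) \<Longrightarrow> generate G S \<subseteq> N <#> F" by auto
  have s: "s \<in> carrier G" using insert.prems by auto
  define F' where "F' = (\<lambda>(f, k). f \<otimes> s [^] (k::nat)) ` (F \<times> {..<p})"
  have "generate G (insert s S) \<subseteq> N <#> F'" if N: "N \<in> fam (carrier G)" for N
  proof -
    have nN: "N \<lhd> G" using N by (simp add: pc_family_def)
    interpret normal N G by fact
    have gS: "subgroup (generate G S) G" using generate_is_subgroup insert.prems by simp
    have gc: "g \<in> carrier G" if "g \<in> generate G S" for g using subgroup.mem_carrier[OF gS that] .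
    have comm: "N #> (a \<otimes> b) = N #> (b \<otimes> a)" if "a \<in> carrier G" "b \<in> carrier G" for a b
      using that N rcos_commute_iff[of a b] by (auto simp: pc_family_def)
    \<comment> \<open>Integer exponents make \<open>X\<close> closed under inverses; they are
      reduced modulo \<open>p\<close> only afterwards.\<close>
    define X where "X = {h \<in> carrier G. \<exists>g\<in>generate G S. \<exists>k::int. N #> h = N #> (g \<otimes> s [^] k)}"
    have "subgroup X G"
    proof (rule subgroupI)
      have "\<one> \<in> X" using generate.one[of G S]
        by (auto simp: X_def intro!: bexI[of _ \<one>] exI[of _ 0])
      thus "X \<noteq> {}" by blast
      show "inv a \<in> X" if a: "a \<in> X" for a
      proof -
        obtain g k where g: "g \<in> generate G S" "N #> a = N #> (g \<otimes> s [^] (k::int))" using a by (auto simp: X_def)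
        have ac: "a \<in> carrier G" using a by (simp add: X_def)
        have "N #> inv a = N #> inv (g \<otimes> s [^] k)" using g gc s ac by (intro rcos_inv_cong) auto
        also have "inv (g \<otimes> s [^] k) = s [^] (- k) \<otimes> inv g" using g gc s by (simp add: inv_mult_group int_pow_neg)
        also have "N #> \<dots> = N #> (inv g \<otimes> s [^] (- k))" using g gc s by (intro comm) auto
        finally show ?thesis using ac subgroup.m_inv_closed[OF gS g(1)] unfolding X_def by blast
      qed
      show "a \<otimes> b \<in> X" if a: "a \<in> X" and b: "b \<in> X" for a b
      proof -
        obtain g k where g: "g \<in> generate G S" "N #> a = N #> (g \<otimes> s [^] (k::int))" using a by (auto simp: X_def)
        obtain h l where h: "h \<in> generate G S" "N #> b = N #> (h \<otimes> s [^] (l::int))" using b by (auto simp: X_def)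
        have c: "a \<in> carrier G" "b \<in> carrier G" "g \<in> carrier G" "h \<in> carrier G"
          using a b g h gc by (auto simp: X_def)
        have "N #> (a \<otimes> b) = N #> ((g \<otimes> s [^] k) \<otimes> (h \<otimes> s [^] l))"
          using c g h s rcos_mult_cong[of a "g \<otimes> s [^] k" b "h \<otimes> s [^] l"] by simp
        also have "(g \<otimes> s [^] k) \<otimes> (h \<otimes> s [^] l) = g \<otimes> ((s [^] k \<otimes> h) \<otimes> s [^] l)"
          using c s by (simp add: m_assoc)
        also have "N #> \<dots> = N #> (g \<otimes> ((h \<otimes> s [^] k) \<otimes> s [^] l))"
          using c s comm[of "s [^] k" h] rcos_mult_cong[of "s [^] k \<otimes> h" "h \<otimes> s [^] k" "s [^] l" "s [^] l"]
            rcos_mult_cong[of g g "(s [^] k \<otimes> h) \<otimes> s [^] l" "(h \<otimes> s [^] k) \<otimes> s [^] l"] by simp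
        also have "g \<otimes> ((h \<otimes> s [^] k) \<otimes> s [^] l) = (g \<otimes> h) \<otimes> s [^] (k + l)"
          using c s by (simp add: m_assoc int_pow_mult)
        finally show ?thesis using c subgroup.m_closed[OF gS g(1) h(1)] unfolding X_def by blast
      qed
    qed (auto simp: X_def)
    moreover have "insert s S \<subseteq> X"
    proof -
      have "N #> s = N #> (\<one> \<otimes> s [^] (1::int))" using s by simp
      hence "s \<in> X" unfolding X_def using generate.one[of G S] s by blast
      moreover have "x \<in> X" if "x \<in> S" for x
      proof -
        have "x \<in> carrier G" using that insert.prems by auto
        moreover from this have "N #> x = N #> (x \<otimes> s [^] (0::int))" by simp
        ultimately show ?thesis unfolding X_def using generate.incl[OF that, of G] by blast
      qed
      ultimately show ?thesis by blast
    qed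
    ultimately have "generate G (insert s S) \<subseteq> X" by (intro generate_subgroup_incl)
    also have "X \<subseteq> N <#> F'"
    proof
      fix h assume "h \<in> X"
      then obtain g k where g: "h \<in> carrier G" "g \<in> generate G S" "N #> h = N #> (g \<otimes> s [^] (k::int))" by (auto simp: X_def)
      obtain n f where f: "n \<in> N" "f \<in> F" "g = n \<otimes> f" using F(3)[OF N] g(2) unfolding set_mult_def by blast
      have fc: "f \<in> carrier G" "n \<in> carrier G" using f F subset by auto
      have p: "p > 0" using prime_p prime_gt_0_nat by blast
      define r where "r = nat (k mod int p)"
      have r: "r < p" "k = int p * (k div int p) + int r" using p by (auto simp: r_def nat_less_iff)
      have "s [^] p \<in> N" using N s by (auto simp: pc_family_def)
      hence sp: "(s [^] p) [^] (k div int p) \<in> N" by (rule subgroup_int_pow_closed[OF is_subgroup])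
      have "s [^] k = (s [^] p) [^] (k div int p) \<otimes> s [^] r"
        using s by (subst r(2)) (simp add: int_pow_mult int_pow_pow flip: int_pow_int)
      hence "s [^] k \<otimes> inv (s [^] r) \<in> N" using sp s by (simp add: m_assoc)
      hence "N #> s [^] k = N #> s [^] r" using rcos_eq_iff s by simp
      moreover have "N #> g = N #> f" using rcos_eq_iff[of g f] f fc by (simp add: m_assoc)
      ultimately have "N #> h = N #> (f \<otimes> s [^] r)"
        using g(3) fc s rcos_mult_cong[of g f "s [^] k" "s [^] r"] gc[OF g(2)] by simp
      hence "h \<otimes> inv (f \<otimes> s [^] r) \<in> N" using rcos_eq_iff[of h "f \<otimes> s [^] r"] g fc s by simp
      moreover have "f \<otimes> s [^] r \<in> F'" using f r by (auto simp: F'_def)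
      ultimately have "h \<otimes> inv (f \<otimes> s [^] r) \<otimes> (f \<otimes> s [^] r) \<in> N <#> F'" unfolding set_mult_def by blast
      moreover have "h \<otimes> inv (f \<otimes> s [^] r) \<otimes> (f \<otimes> s [^] r) = h" using g fc s by (simp add: m_assoc inv_mult_group)
      ultimately show "h \<in> N <#> F'" by simp
    qed
    finally show ?thesis .
  qed
  moreover have "finite F'" "F' \<subseteq> carrier G" using F s by (auto simp: F'_def)
  ultimately show ?case by blast
qed

end

context uniform
begin

lemma V1_open: "openin T (V (Suc 0))"
proof -
  obtain S where S: "finite S" "topologically_generates G T S" using fin_gen by blast
  hence Sc: "S \<subseteq> carrier G" by (simp add: topologically_generates_def)
  obtain F where F: "finite F" "F \<subseteq> carrier G" "\<And>N. N \<in> fam (carrier G) \<Longrightarrow> generate G S \<subseteq> N <#> F"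
    using finite_cover_generate[OF S(1) Sc] by blast
  show ?thesis
  proof (rule V_open_of_cover[OF _ F(1,2)])
    fix N assume N: "N \<in> fam (V 0)"
    have NF: "N <#> F \<subseteq> carrier G" using N F pc_familyD(3)[OF N] by (intro setmult_subset_G) (auto dest: subgroup.subset)
    have "carrier G = T closure_of generate G S" using S by (simp add: topologically_generates_def)
    also have "\<dots> \<subseteq> N <#> generate G S"
      using closure_subset_mult[OF pc_familyD(3,2)[OF N]] generate_incl[OF Sc] by blast
    also have "\<dots> \<subseteq> N <#> (N <#> F)" using F(3)[of N] N by (intro mono_set_mult) auto
    also have "\<dots> = N <#> F"
      using set_mult_assoc[of N N F] subgroup_mult_id[OF pc_familyD(3)[OF N]] F subgroup.subset[OF pc_familyD(3)[OF N]] by simp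
    finally show "V 0 \<subseteq> N <#> F" by simp
  qed (use openin_topspace[of T] in simp)
qed

lemma V_in_fam: "openin T (V (Suc n)) \<Longrightarrow> V (Suc n) \<in> fam (V n)"
  unfolding pc_family_def using V_normal V_pow V_comm by blast

text \<open>Openness and surjectivity feed each other: surjectivity modulo all members of
  \<open>fam (V (Suc n))\<close> gives a common finite cover, so the next term is open; being open,
  it is itself a member of that family, and surjectivity holds modulo it.\<close>

lemma V_open_pow_onto:
  "openin T (V n) \<and> openin T (V (Suc n)) \<and> (\<forall>m. n = Suc m \<longrightarrow> pow_onto m (V (Suc n)))"
proof (induction n)
  case 0
  thus ?case using V1_open openin_topspace[of T] by simp
next
  case (Suc n)
  have onto: "pow_onto n N" if "N \<in> fam (V (Suc n))" for N
    using pow_onto_fam[OF that] Suc by blast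
  have "openin T (V (Suc (Suc n)))"
  proof -
    obtain F0 where F0: "finite F0" "F0 \<subseteq> carrier G" "carrier G \<subseteq> V (Suc n) <#> F0"
      using open_subgroup_finite_index[OF V_subgroup] Suc by blast
    \<comment> \<open>Every element of \<open>V (Suc n)\<close> is congruent modulo \<open>N\<close>
      to some \<open>y [^] p\<close>, and by \<open>V_pow_cong\<close> only the coset of
      \<open>y\<close> modulo \<open>V (Suc n)\<close> matters.\<close>
    define F where "F = (\<lambda>f. f [^] p) ` F0"
    have "V (Suc n) \<subseteq> N <#> F" if N: "N \<in> fam (V (Suc n))" for N
    proof
      fix v assume v: "v \<in> V (Suc n)"
      obtain y where y: "y \<in> V n" "N #> v = N #> (y [^] p)" using onto[OF N] v by (auto simp: pow_onto_def)
      have yc: "y \<in> carrier G" using V_carrier[OF y(1)] .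
      obtain t f where tf: "t \<in> V (Suc n)" "f \<in> F0" "y = t \<otimes> f" using F0 yc unfolding set_mult_def by blast
      have c: "t \<in> carrier G" "f \<in> carrier G" "v \<in> carrier G" using tf F0 V_carrier v by auto
      interpret N: normal N G by (rule pc_familyD(1)[OF N])
      have "V (Suc n) #> y = V (Suc n) #> f"
        using normal.rcos_eq_iff[OF V_normal, of y f "Suc n"] tf c by (simp add: m_assoc)
      hence "V (Suc (Suc n)) #> (y [^] p) = V (Suc (Suc n)) #> (f [^] p)" by (rule V_pow_cong[OF yc c(2)])
      hence "y [^] p \<otimes> inv (f [^] p) \<in> V (Suc (Suc n))"
        using normal.rcos_eq_iff[OF V_normal, of "y [^] p" "f [^] p" "Suc (Suc n)"] yc c by simp
      hence "N #> (y [^] p) = N #> (f [^] p)"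
        using N.rcos_eq_iff[of "y [^] p" "f [^] p"] yc c N by (auto simp: pcs.simps)
      hence "v \<otimes> inv (f [^] p) \<in> N" using y N.rcos_eq_iff[of v "f [^] p"] c by simp
      hence "v \<otimes> inv (f [^] p) \<otimes> f [^] p \<in> N <#> F" using tf unfolding set_mult_def F_def by blast
      thus "v \<in> N <#> F" using c by (simp add: m_assoc)
    qed
    moreover have "finite F" "F \<subseteq> carrier G" using F0 by (auto simp: F_def)
    ultimately show ?thesis using V_open_of_cover[of "Suc n" F] Suc by blast
  qed
  thus ?case using onto[OF V_in_fam] Suc by blast
qed

lemma V_open: "openin T (V n)"
  using V_open_pow_onto by blast

lemma V_pow_onto:
  assumes "v \<in> V (Suc n)"
  obtains y where "y \<in> V n" "V (Suc (Suc n)) #> v = V (Suc (Suc n)) #> (y [^] p)"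
  using V_open_pow_onto[of "Suc n"] assms unfolding pow_onto_def by blast

section \<open>The isomorphism from \<open>V 0 / V 1\<close> to \<open>V n / V (n + 1)\<close> given
  by \<open>p^n\<close>-th powers\<close>

lemma V_pow_iter_mult:
  assumes "a \<in> carrier G" "b \<in> carrier G"
  shows "V (Suc n) #> ((a \<otimes> b) [^] (p ^ n)) = V (Suc n) #> (a [^] (p ^ n) \<otimes> b [^] (p ^ n))"
proof (induction n)
  case (Suc n)
  have pp: "(x [^] (p ^ n)) [^] p = x [^] (p ^ Suc n)" if "x \<in> carrier G" for x
    using that by (simp add: nat_pow_pow mult.commute)
  have "b [^] (p ^ n) \<in> V n" using V_pow_iter[of b 0 n] assms by simp
  hence "V (Suc (Suc n)) #> ((a [^] (p ^ n) \<otimes> b [^] (p ^ n)) [^] p)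
      = V (Suc (Suc n)) #> (a [^] (p ^ Suc n) \<otimes> b [^] (p ^ Suc n))"
    using V_pow_mult[of "a [^] (p ^ n)" "b [^] (p ^ n)" n] assms pp by simp
  thus ?case using V_pow_cong[OF _ _ Suc] assms pp[of "a \<otimes> b"] by simp
qed (use assms in simp)

lemma V_pow_iter_onto:
  assumes "v \<in> V n"
  shows "\<exists>x\<in>carrier G. V (Suc n) #> v = V (Suc n) #> (x [^] (p ^ n))"
  using assms
proof (induction n arbitrary: v)
  case (Suc n)
  obtain y where y: "y \<in> V n" "V (Suc (Suc n)) #> v = V (Suc (Suc n)) #> (y [^] p)"
    using V_pow_onto[OF Suc.prems] .
  obtain x where x: "x \<in> carrier G" "V (Suc n) #> y = V (Suc n) #> (x [^] (p ^ n))"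
    using Suc.IH[OF y(1)] by blast
  have "(x [^] (p ^ n)) [^] p = x [^] (p ^ Suc n)"
    using x by (simp add: nat_pow_pow mult.commute)
  thus ?case using V_pow_cong[OF V_carrier[OF y(1)] _ x(2)] x y by auto
qed auto

text \<open>The sets \<open>C m\<close> collect the elements of the coset of \<open>v\<close> modulo
  \<open>V (Suc n)\<close> whose \<open>p\<close>-th power lies in \<open>V m\<close>. They are
  closed, nested and nonempty, so compactness yields an element of the coset with trivial
  \<open>p\<close>-th power. By torsion-freeness it is the identity, and the coset is
  \<open>V (Suc n)\<close> itself.\<close>

lemma V_pow_inj:
  assumes v: "v \<in> V n" and vp: "v [^] p \<in> V (Suc (Suc n))"
  shows "v \<in> V (Suc n)"
proof -
  have vc: "v \<in> carrier G" using V_carrier[OF v] .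
  define C where "C m = {y \<in> carrier G. y \<otimes> inv v \<in> V (Suc n)} \<inter> {y \<in> carrier G. y [^] p \<in> V m}" for m
  have mono: "C m' \<subseteq> C m" if "m \<le> m'" for m m' using V_mono[OF that] by (auto simp: C_def)
  \<comment> \<open>Successive approximation: surjectivity provides
    \<open>z \<in> V (Suc (n + k))\<close> whose \<open>p\<close>-th power agrees with that of
    \<open>y\<close> one level deeper, and \<open>y \<otimes> inv z\<close> is the next
    approximation in the same coset.\<close>
  have ne: "C (Suc (Suc (n + k))) \<noteq> {}" for k
  proof (induction k)
    case 0
    have "v \<in> C (Suc (Suc n))" using vp vc subgroup.one_closed[OF V_subgroup] by (auto simp: C_def)
    thus ?case by auto
  next
    case (Suc k)
    then obtain y where y: "y \<in> carrier G" "y \<otimes> inv v \<in> V (Suc n)" "y [^] p \<in> V (Suc (Suc (n + k)))"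
      by (auto simp: C_def)
    let ?W = "V (Suc (Suc (Suc (n + k))))"
    interpret normal ?W G by (rule V_normal)
    obtain z where z: "z \<in> V (Suc (n + k))" "?W #> (y [^] p) = ?W #> (z [^] p)"
      using V_pow_onto[OF y(3)] .
    have zc: "z \<in> carrier G" using V_carrier[OF z(1)] .
    have "?W #> ((y \<otimes> inv z) [^] p) = ?W #> (y [^] p \<otimes> inv z [^] p)"
      by (rule V_pow_mult[OF y(1) V_inv[OF z(1)]])
    also have "\<dots> = ?W #> (z [^] p \<otimes> inv z [^] p)"
      using y z zc rcos_mult_cong[of "y [^] p" "z [^] p" "inv z [^] p" "inv z [^] p"] by simp
    also have "z [^] p \<otimes> inv z [^] p = \<one>" using zc by (simp add: nat_pow_inv)
    finally have "(y \<otimes> inv z) [^] p \<in> ?W"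
      using rcos_mem_cong[of "(y \<otimes> inv z) [^] p" \<one>] y zc one_closed by simp
    moreover have "y \<otimes> inv z \<otimes> inv v \<in> V (Suc n)"
    proof -
      have "inv z \<in> V (Suc n)" using V_inv[OF z(1)] V_mono[of "Suc n" "Suc (n + k)"] by auto
      hence "y \<otimes> inv z \<otimes> inv y \<in> V (Suc n)" using V_conj y(1) by blast
      hence "(y \<otimes> inv z \<otimes> inv y) \<otimes> (y \<otimes> inv v) \<in> V (Suc n)" using y(2) by (rule V_mult)
      thus ?thesis using y zc vc by (simp add: m_assoc)
    qed
    ultimately have "y \<otimes> inv z \<in> C (Suc (Suc (n + Suc k)))" using y zc by (simp add: C_def)
    thus ?case by blast
  qed
  have Cne: "C m \<noteq> {}" for m
    using ne[of m] mono[of m "Suc (Suc (n + m))"] by auto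
  have "closedin T {y \<in> carrier G. y \<otimes> inv v \<in> V (Suc n)}"
    using closedin_continuous_map_preimage[OF continuous_mult open_subgroup_closed[OF V_subgroup V_open],
        of T "\<lambda>y. y" "\<lambda>y. inv v" "Suc n"] vc by simp
  moreover have "closedin T {y \<in> carrier G. y [^] p \<in> V m}" for m
    using closedin_continuous_map_preimage[OF continuous_pow open_subgroup_closed[OF V_subgroup V_open], of p m] by simp
  ultimately have "closedin T (C m)" for m by (auto simp: C_def)
  moreover have "decseq C" using mono by (simp add: decseq_def)
  ultimately have "(\<Inter>m. C m) \<noteq> {}" using compact_space_imp_nest[OF compact] Cne by blast
  then obtain y where y: "\<And>m. y \<in> C m" by blast
  hence yc: "y \<in> carrier G" by (simp add: C_def)
  have "y [^] p = \<one>" using y by (intro V_Inter) (simp add: C_def)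
  hence "y = \<one>" using torsion_free yc prime_gt_0_nat[OF prime_p] by (auto simp: torsion_free_def)
  hence "inv v \<in> V (Suc n)" using y[of 0] vc by (simp add: C_def)
  thus ?thesis using V_inv[of "inv v"] vc by simp
qed

lemma V_pow_iter_inj:
  assumes "x \<in> carrier G" "x [^] (p ^ n) \<in> V (Suc n)" shows "x \<in> V (Suc 0)"
  using assms
proof (induction n)
  case (Suc n)
  have "(x [^] (p ^ n)) [^] p = x [^] (p ^ Suc n)"
    using Suc.prems by (simp add: nat_pow_pow mult.commute)
  thus ?case using V_pow_inj[of "x [^] (p ^ n)" n] V_pow_iter[of x 0 n] Suc by simp
qed simp

text \<open>An element of \<open>V n\<close> is congruent to a \<open>p^n\<close>-th power of some
  \<open>x = v k\<close> with \<open>v \<in> V (Suc 0)\<close> and \<open>k \<in> H\<close>. The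
  power of \<open>v\<close> falls into \<open>V (Suc n)\<close>, so the power of \<open>k\<close>,
  an element of \<open>H\<close>, represents it.\<close>

lemma frattini:
  assumes H: "subgroup H G" and cov: "carrier G \<subseteq> V (Suc 0) <#> H"
  shows "carrier G \<subseteq> V n <#> H"
proof (induction n)
  case 0
  show ?case
  proof
    fix x assume "x \<in> carrier G"
    hence "x \<in> V 0" by simp
    hence "x \<otimes> \<one> \<in> V 0 <#> H" unfolding set_mult_def using subgroup.one_closed[OF H] by blast
    thus "x \<in> V 0 <#> H" using \<open>x \<in> carrier G\<close> by simp
  qed
next
  case (Suc n)
  interpret H: subgroup H G by fact
  interpret N: normal "V (Suc n)" G by (rule V_normal)
  show ?case
  proof
    fix g assume g: "g \<in> carrier G"
    obtain t h where th: "t \<in> V n" "h \<in> H" "g = t \<otimes> h" using Suc g unfolding set_mult_def by blast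
    obtain x where x: "x \<in> carrier G" "V (Suc n) #> t = V (Suc n) #> (x [^] (p ^ n))"
      using V_pow_iter_onto[OF th(1)] by blast
    obtain v k where vk: "v \<in> V (Suc 0)" "k \<in> H" "x = v \<otimes> k" using cov x unfolding set_mult_def by blast
    have c: "v \<in> carrier G" "k \<in> carrier G" "h \<in> carrier G" "t \<in> carrier G" using vk th V_carrier by auto
    have vp: "v [^] (p ^ n) \<in> V (Suc n)" using V_pow_iter[OF vk(1), of n] by simp
    have "V (Suc n) #> (x [^] (p ^ n)) = V (Suc n) #> (v [^] (p ^ n) \<otimes> k [^] (p ^ n))"
      unfolding vk(3) by (rule V_pow_iter_mult) (use c in auto)
    also have "\<dots> = V (Suc n) #> (k [^] (p ^ n))"
      using N.rcos_eq_iff[of "v [^] (p ^ n) \<otimes> k [^] (p ^ n)" "k [^] (p ^ n)"] c vp by (simp add: m_assoc)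
    finally have "t \<otimes> inv (k [^] (p ^ n)) \<in> V (Suc n)"
      using N.rcos_eq_iff[of t "k [^] (p ^ n)"] x c by simp
    moreover have "k [^] (p ^ n) \<in> H" using subgroup_int_pow_closed[OF H vk(2), of "int (p ^ n)"] unfolding int_pow_int .
    hence "k [^] (p ^ n) \<otimes> h \<in> H" using th by simp
    ultimately have "t \<otimes> inv (k [^] (p ^ n)) \<otimes> (k [^] (p ^ n) \<otimes> h) \<in> V (Suc n) <#> H"
      unfolding set_mult_def by blast
    thus "g \<in> V (Suc n) <#> H" using c th by (simp add: m_assoc)
  qed
qed

lemma frattini_dense:
  assumes H: "subgroup H G" and cov: "carrier G \<subseteq> V (Suc 0) <#> H"
  shows "T closure_of H = carrier G"
proof
  show "T closure_of H \<subseteq> carrier G" using closure_of_subset_topspace[of T H] by simp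
  show "carrier G \<subseteq> T closure_of H"
  proof
    fix x assume x: "x \<in> carrier G"
    have "\<exists>y. y \<in> H \<and> y \<in> B" if B: "x \<in> B" "openin T B" for B
    proof -
      let ?B = "{y \<in> carrier G. y \<otimes> x \<in> B}"
      have "openin T ?B" by (rule open_right_preimage[OF x B(2)])
      moreover have "\<one> \<in> ?B" using x B by simp
      ultimately obtain N where N: "N \<lhd> G" "openin T N" "N \<subseteq> ?B" using open_normal_basis by blast
      obtain n where n: "V n \<subseteq> N" using V_basis[OF N(1,2)] .
      obtain t h where th: "t \<in> V n" "h \<in> H" "x = t \<otimes> h"
        using frattini[OF assms, of n] x unfolding set_mult_def by blast
      have c: "t \<in> carrier G" "h \<in> carrier G" using th V_carrier subgroup.mem_carrier[OF H] by auto
      have "inv t \<in> ?B" using V_inv[OF th(1)] n N by blast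
      hence "h \<in> B" using th c by simp
      thus ?thesis using th by blast
    qed
    thus "x \<in> T closure_of H" using x by (auto simp: in_closure_of)
  qed
qed

end

section \<open>Counting cosets\<close>

lemma (in group) set_mult_memI: "a \<in> A \<Longrightarrow> b \<in> B \<Longrightarrow> a \<otimes> b \<in> A <#> B"
  unfolding set_mult_def by blast

lemma (in group) set_mult_memE:
  assumes "x \<in> A <#> B" obtains a b where "a \<in> A" "b \<in> B" "x = a \<otimes> b"
  using assms unfolding set_mult_def by blast

lemma card_set_mult_le:
  assumes "finite A" "finite B"
  shows "finite (A <#>\<^bsub>G\<^esub> B)" "card (A <#>\<^bsub>G\<^esub> B) \<le> card A * card B"
proof -
  have "A <#>\<^bsub>G\<^esub> B = (\<lambda>(a, b). a \<otimes>\<^bsub>G\<^esub> b) ` (A \<times> B)" by (auto simp: set_mult_def)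
  thus "finite (A <#>\<^bsub>G\<^esub> B)" "card (A <#>\<^bsub>G\<^esub> B) \<le> card A * card B"
    using assms card_image_le[of "A \<times> B" "\<lambda>(a, b). a \<otimes>\<^bsub>G\<^esub> b"] by (auto simp: card_cartesian_product)
qed

lemma (in normal) set_mult_cover_mult:
  assumes "A \<subseteq> H <#> E" "B \<subseteq> H <#> F" "E \<subseteq> carrier G" "F \<subseteq> carrier G"
  shows "A <#> B \<subseteq> H <#> (E <#> F)"
proof
  fix x assume "x \<in> A <#> B"
  then obtain a b where ab: "a \<in> A" "b \<in> B" "x = a \<otimes> b" by (rule set_mult_memE)
  obtain h e where he: "h \<in> H" "e \<in> E" "a = h \<otimes> e" using ab assms by (blast elim: set_mult_memE)
  obtain k f where kf: "k \<in> H" "f \<in> F" "b = k \<otimes> f" using ab assms by (blast elim: set_mult_memE)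
  have c: "h \<in> carrier G" "k \<in> carrier G" "e \<in> carrier G" "f \<in> carrier G"
    using he kf assms subset by auto
  have "h \<otimes> (e \<otimes> k \<otimes> inv e) \<in> H"
    using he kf c subgroup.m_closed[OF is_subgroup] inv_op_closed2 by simp
  moreover have "e \<otimes> f \<in> E <#> F" using he kf set_mult_memI by blast
  ultimately have "h \<otimes> (e \<otimes> k \<otimes> inv e) \<otimes> (e \<otimes> f) \<in> H <#> (E <#> F)" by (rule set_mult_memI)
  thus "x \<in> H <#> (E <#> F)" using c ab he kf by (simp add: m_assoc)
qed

lemma (in group) generate_singleton_cover:
  assumes N: "subgroup N G" and y: "y \<in> carrier G" and m: "m > 0" and ym: "y [^] (m::nat) \<in> N"
  shows "generate G {y} \<subseteq> N <#> ((\<lambda>i. y [^] i) ` {..<m})"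
proof
  fix z assume "z \<in> generate G {y}"
  then obtain k :: int where k: "z = y [^] k" using generate_pow[OF y] by auto
  define r where "r = nat (k mod int m)"
  have r: "r < m" "k = int m * (k div int m) + int r" using m by (auto simp: r_def nat_less_iff)
  have sp: "(y [^] m) [^] (k div int m) \<in> N" by (rule subgroup_int_pow_closed[OF N ym])
  have "z = (y [^] m) [^] (k div int m) \<otimes> y [^] r"
    unfolding k using y by (subst r(2)) (simp add: int_pow_mult int_pow_pow flip: int_pow_int)
  thus "z \<in> N <#> ((\<lambda>i. y [^] i) ` {..<m})" using sp r by (auto intro: set_mult_memI)
qed

context top_group
begin

lemma procyclic_cover:
  assumes N: "N \<lhd> G" "openin T N" and y: "y \<in> carrier G" and m: "m > 0" and ym: "y [^] (m::nat) \<in> N"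
  shows "procyclic G T y \<subseteq> N <#> ((\<lambda>i. y [^] i) ` {..<m})"
proof -
  have sN: "subgroup N G" using N normal_imp_subgroup by blast
  let ?F = "(\<lambda>i. y [^] i) ` {..<m}"
  have "procyclic G T y \<subseteq> N <#> generate G {y}"
    unfolding procyclic_def using y by (intro closure_subset_mult[OF sN N(2)] generate_incl) auto
  also have "\<dots> \<subseteq> N <#> (N <#> ?F)"
    by (intro mono_set_mult order_refl generate_singleton_cover[OF sN y m ym])
  also have "\<dots> = N <#> ?F"
    using set_mult_assoc[of N N ?F] subgroup_mult_id[OF sN] y subgroup.subset[OF sN] by (simp add: image_subset_iff)
  finally show ?thesis .
qed

text \<open>Modulo \<open>N\<close> the \<open>k\<close>-th factor has at most \<open>m k\<close>
  elements, and normality of \<open>N\<close> allows covers to be multiplied. Coincidences among the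
  products do no harm to an upper bound.\<close>

lemma set_product_cover:
  assumes N: "N \<lhd> G" "openin T N"
    and "\<And>k. k \<in> {1..d} \<Longrightarrow> y k \<in> carrier G \<and> m k > 0 \<and> y k [^] (m k :: nat) \<in> N"
  shows "\<exists>F. finite F \<and> F \<subseteq> carrier G \<and> card F \<le> (\<Prod>k\<in>{1..d}. m k) \<and>
    set_product G d (\<lambda>k. procyclic G T (y k)) \<subseteq> N <#> F"
  using assms(3)
proof (induction d)
  case 0
  have "\<one> \<in> N" using N normal_imp_subgroup subgroup.one_closed by blast
  hence "\<one> \<otimes> \<one> \<in> N <#> {\<one>}" by (intro set_mult_memI) auto
  thus ?case by (intro exI[of _ "{\<one>}"]) auto
next
  case (Suc d)
  interpret normal N G by fact
  obtain F where F: "finite F" "F \<subseteq> carrier G" "card F \<le> (\<Prod>k\<in>{1..d}. m k)"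
    "set_product G d (\<lambda>k. procyclic G T (y k)) \<subseteq> N <#> F"
    using Suc by auto
  let ?y = "y (Suc d)" and ?m = "m (Suc d)"
  let ?E = "(\<lambda>i. ?y [^] i) ` {..<?m}"
  have y: "?y \<in> carrier G" "?m > 0" "?y [^] ?m \<in> N" using Suc.prems[of "Suc d"] by auto
  have E: "finite ?E" "card ?E \<le> ?m" "?E \<subseteq> carrier G" using y card_image_le[of "{..<?m}" "\<lambda>i. ?y [^] i"] by auto
  have "set_product G (Suc d) (\<lambda>k. procyclic G T (y k)) \<subseteq> N <#> (F <#> ?E)"
    unfolding set_product.simps by (intro set_mult_cover_mult F E procyclic_cover N y)
  moreover have "card (F <#> ?E) \<le> (\<Prod>k\<in>{1..Suc d}. m k)"
    using card_set_mult_le(2)[OF F(1) E(1), of G] mult_le_mono[OF F(3) E(2)]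
    by (simp add: mult.commute)
  moreover have "F <#> ?E \<subseteq> carrier G" using F E by (intro setmult_subset_G) auto
  ultimately show ?case using card_set_mult_le(1)[OF F(1) E(1), of G] by blast
qed

end

section \<open>Lower bounds for the index of \<open>V n\<close>\<close>

context uniform
begin

text \<open>The counterpart of the covers: pairwise incongruent elements bound the number of
  representatives from below.\<close>

definition separated :: "nat \<Rightarrow> 'a set \<Rightarrow> bool" where
  "separated n E \<longleftrightarrow> E \<subseteq> carrier G \<and> (\<forall>a\<in>E. \<forall>b\<in>E. V n #> a = V n #> b \<longrightarrow> a = b)"

lemma card_separated_le:
  assumes E: "separated n E" and F: "finite F" "F \<subseteq> carrier G" "carrier G \<subseteq> V n <#> F"
  shows "card E \<le> card F"
proof -
  interpret normal "V n" G by (rule V_normal)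
  have "\<exists>f\<in>F. V n #> e = V n #> f" if "e \<in> E" for e
  proof -
    have "e \<in> carrier G" using E that by (auto simp: separated_def)
    then obtain v f where vf: "v \<in> V n" "f \<in> F" "e = v \<otimes> f" using F by (blast elim: set_mult_memE)
    have "v \<in> carrier G" "f \<in> carrier G" using vf V_carrier F by auto
    hence "V n #> e = V n #> f" using rcos_eq_iff[of e f] vf by (simp add: m_assoc)
    thus ?thesis using vf by blast
  qed
  then obtain \<phi> where \<phi>: "\<And>e. e \<in> E \<Longrightarrow> \<phi> e \<in> F \<and> V n #> e = V n #> \<phi> e" by metis
  have "inj_on \<phi> E"
  proof (rule inj_onI)
    fix a b assume ab: "a \<in> E" "b \<in> E" "\<phi> a = \<phi> b"
    hence "V n #> a = V n #> b" using \<phi>[of a] \<phi>[of b] by simp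
    thus "a = b" using E ab by (simp add: separated_def)
  qed
  thus ?thesis using \<phi> F by (intro card_inj_on_le) auto
qed

text \<open>Since \<open>x k [^] p\<close> lies in \<open>V (Suc 0)\<close>, Bezout would put
  \<open>x k\<close> itself into the subgroup \<open>K\<close> spanned by \<open>V (Suc 0)\<close>
  and the other generators. As \<open>K\<close> is open it would be all of \<open>G\<close>, and by
  \<open>frattini_dense\<close> the other generators alone would suffice, against
  minimality.\<close>

lemma minimal_generator_independent:
  assumes min: "minimal_generating_system G T d x" and k: "k \<in> {1..d}"
    and m: "\<not> int p dvd m"
  shows "x k [^] (m::int) \<notin> V (Suc 0) <#> generate G (x ` {1..<k})"
proof
  assume mem: "x k [^] m \<in> V (Suc 0) <#> generate G (x ` {1..<k})"
  let ?V = "V (Suc 0)"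
  have x: "x i \<in> carrier G" if "i \<in> {1..d}" for i
    using min that by (auto simp: minimal_generating_system_def topologically_generates_def)
  define J where "J = {1..d} - {k}"
  have JC: "x ` J \<subseteq> carrier G" using x by (auto simp: J_def)
  have sJ: "subgroup (generate G (x ` J)) G" by (rule generate_is_subgroup[OF JC])
  define K where "K = ?V <#> generate G (x ` J)"
  have sK: "subgroup K G" unfolding K_def by (rule mult_norm_subgroup[OF V_normal sJ])
  have one: "\<one> \<in> ?V" "\<one> \<in> generate G (x ` J)"
    using subgroup.one_closed[OF V_subgroup] subgroup.one_closed[OF sJ] by auto
  have VK: "?V \<subseteq> K"
  proof
    fix v assume v: "v \<in> ?V"
    hence "v \<otimes> \<one> \<in> K" unfolding K_def by (intro set_mult_memI one)
    thus "v \<in> K" using V_carrier[OF v] by simp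
  qed
  have gK: "g \<in> K" if "g \<in> generate G (x ` J)" for g
  proof -
    have "\<one> \<otimes> g \<in> K" unfolding K_def using that by (intro set_mult_memI one)
    thus ?thesis using subgroup.mem_carrier[OF sJ that] by simp
  qed
  have "generate G (x ` {1..<k}) \<subseteq> generate G (x ` J)"
    using k by (intro mono_generate image_mono) (auto simp: J_def)
  hence xm: "x k [^] m \<in> K" using mem mono_set_mult[of ?V ?V] unfolding K_def by blast
  have xk: "x k \<in> carrier G" using x k by blast
  have xp: "x k [^] int p \<in> K"
    using VK V_pow[of "x k" 0] xk unfolding int_pow_int by auto
  have "coprime (int p) m" using prime_p m by (intro prime_imp_coprime) auto
  then obtain u v where uv: "u * int p + v * m = 1" using bezout_int[of "int p" m] by auto
  have "(x k [^] int p) [^] u \<otimes> (x k [^] m) [^] v \<in> K"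
    using xp xm subgroup.m_closed[OF sK] subgroup_int_pow_closed[OF sK] by blast
  moreover have "(x k [^] int p) [^] u \<otimes> (x k [^] m) [^] v = x k [^] (u * int p + v * m)"
    using xk by (simp add: int_pow_mult int_pow_pow mult.commute)
  ultimately have "x k \<in> K" unfolding uv using xk by simp
  moreover have "x i \<in> K" if "i \<in> J" for i
    using that by (intro gK generate.incl) auto
  ultimately have "x ` {1..d} \<subseteq> K" unfolding J_def by blast
  moreover have oK: "openin T K" by (rule open_subgroup_mono[OF V_subgroup V_open sK VK])
  ultimately have "T closure_of generate G (x ` {1..d}) \<subseteq> K"
    by (intro closure_subset_open_subgroup[OF sK] generate_subgroup_incl[OF _ sK])
  hence "carrier G \<subseteq> K"
    using min by (simp add: minimal_generating_system_def topologically_generates_def)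
  hence "T closure_of generate G (x ` J) = carrier G"
    unfolding K_def by (intro frattini_dense sJ)
  hence "topologically_generates G T (x ` J)" using JC by (simp add: topologically_generates_def)
  moreover have "J \<subset> {1..d}" using k unfolding J_def by blast
  ultimately show False using min unfolding minimal_generating_system_def by blast
qed

text \<open>The elements are ordered products of powers of the first \<open>k\<close> generators
  with exponents below \<open>p\<close>. Keeping them in the subgroup generated by these is what
  makes \<open>minimal_generator_independent\<close> applicable to the next generator.\<close>

lemma separated_generators:
  assumes min: "minimal_generating_system G T d x" and "k \<le> d"
  shows "\<exists>E\<subseteq>generate G (x ` {1..k}). finite E \<and> card E = p ^ k \<and> separated (Suc 0) E"
  using assms(2)
proof (induction k)
  case 0
  show ?case using generate.one[of G "{}"] by (intro exI[of _ "{\<one>}"]) (auto simp: separated_def)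
next
  case (Suc k)
  interpret normal "V (Suc 0)" G by (rule V_normal)
  let ?V = "V (Suc 0)" and ?y = "x (Suc k)"
  have x: "x i \<in> carrier G" if "i \<in> {1..d}" for i
    using min that by (auto simp: minimal_generating_system_def topologically_generates_def)
  have y: "?y \<in> carrier G" using x Suc.prems by auto
  let ?H = "generate G (x ` {1..k})"
  have sH: "subgroup ?H G" using x Suc.prems by (intro generate_is_subgroup) auto
  obtain E where E: "E \<subseteq> ?H" "finite E" "card E = p ^ k" "separated (Suc 0) E" using Suc by auto
  have Ec: "e \<in> carrier G" if "e \<in> E" for e using that E by (auto simp: separated_def)
  define \<phi> where "\<phi> = (\<lambda>(e, i::nat). e \<otimes> ?y [^] i)"
  have key: "e = e' \<and> i = j" if e: "e \<in> E" "e' \<in> E" and i: "i < p" "j < p"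
    and eq: "?V #> (e \<otimes> ?y [^] i) = ?V #> (e' \<otimes> ?y [^] j)" for e e' and i j :: nat
  proof -
    have c: "e \<in> carrier G" "e' \<in> carrier G" using e Ec by auto
    define t where "t = e \<otimes> ?y [^] i \<otimes> inv (e' \<otimes> ?y [^] j)"
    have t: "t \<in> ?V" unfolding t_def using eq c y rcos_eq_iff[of "e \<otimes> ?y [^] i" "e' \<otimes> ?y [^] j"] by simp
    have tc: "t \<in> carrier G" using V_carrier[OF t] .
    have ij: "?y [^] (int i - int j) = ?y [^] i \<otimes> inv (?y [^] j)"
      using y by (simp add: int_pow_diff int_pow_int)
    \<comment> \<open>The congruence is solved for the new generator: its power with exponent
      \<open>i - j\<close> falls into \<open>?V\<close> times the subgroup of the earlier
      ones.\<close>
    have "inv e \<otimes> t \<otimes> inv (inv e) \<otimes> (inv e \<otimes> e') = ?y [^] (int i - int j)"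
      unfolding t_def ij using c y by (simp add: m_assoc inv_mult_group)
    moreover have "inv e \<otimes> t \<otimes> inv (inv e) \<in> ?V" using t c by (intro V_conj) auto
    moreover have "inv e \<otimes> e' \<in> ?H"
      using e E(1) subgroup.m_closed[OF sH] subgroup.m_inv_closed[OF sH] by blast
    ultimately have mem: "?y [^] (int i - int j) \<in> ?V <#> ?H" by (metis set_mult_memI)
    have "int p dvd int i - int j"
    proof (rule ccontr)
      assume "\<not> ?thesis"
      thus False using minimal_generator_independent[OF min, of "Suc k" "int i - int j"] Suc.prems mem
        by (simp add: atLeastLessThanSuc_atLeastAtMost)
    qed
    hence "i = j"
      using i dvd_imp_le_int[of "int i - int j" "int p"] by arith
    moreover have "e = e'"
    proof -
      have "e \<otimes> inv e' \<in> ?V" using t c y \<open>i = j\<close> by (simp add: t_def m_assoc inv_mult_group)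
      hence "?V #> e = ?V #> e'" using rcos_eq_iff c by simp
      thus ?thesis using E(4) e by (simp add: separated_def)
    qed
    ultimately show ?thesis by simp
  qed
  let ?E = "\<phi> ` (E \<times> {..<p})"
  have "inj_on \<phi> (E \<times> {..<p})" using key by (auto simp: inj_on_def \<phi>_def)
  hence "card ?E = p ^ Suc k" using E by (simp add: card_image card_cartesian_product)
  moreover have "separated (Suc 0) ?E" unfolding separated_def
  proof (intro conjI ballI impI)
    show "?E \<subseteq> carrier G" using Ec y by (auto simp: \<phi>_def)
    fix a b assume ab: "a \<in> ?E" "b \<in> ?E" "?V #> a = ?V #> b"
    obtain e i where a: "e \<in> E" "i < p" "a = e \<otimes> ?y [^] i" using ab by (auto simp: \<phi>_def)
    obtain e' j where b: "e' \<in> E" "j < p" "b = e' \<otimes> ?y [^] j" using ab by (auto simp: \<phi>_def)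
    show "a = b" using key[OF a(1) b(1) a(2) b(2)] ab a b by simp
  qed
  moreover have "?E \<subseteq> generate G (x ` {1..Suc k})"
  proof -
    have sH': "subgroup (generate G (x ` {1..Suc k})) G" using x Suc.prems by (intro generate_is_subgroup) auto
    have "?H \<subseteq> generate G (x ` {1..Suc k})" by (intro mono_generate) auto
    moreover have "?y \<in> generate G (x ` {1..Suc k})" by (intro generate.incl) auto
    hence "?y [^] int i \<in> generate G (x ` {1..Suc k})" for i by (rule subgroup_int_pow_closed[OF sH'])
    ultimately show ?thesis using E(1) subgroup.m_closed[OF sH'] unfolding \<phi>_def int_pow_int by fast
  qed
  moreover have "finite ?E" using E by simp
  ultimately show ?case by blast
qed

text \<open>Products \<open>f \<otimes> e [^] (p ^ n)\<close> with \<open>f\<close> from the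
  previous level: modulo \<open>V n\<close> the second factor disappears, which determines
  \<open>f\<close>; then \<open>e\<close> is determined because the \<open>p^n\<close>-th power map
  is injective on cosets of \<open>V (Suc 0)\<close>.\<close>

lemma separated_powers:
  assumes E: "finite E" "separated (Suc 0) E"
  shows "\<exists>F. finite F \<and> card F = card E ^ n \<and> separated n F"
proof (induction n)
  case 0
  show ?case by (intro exI[of _ "{\<one>}"]) (auto simp: separated_def)
next
  case (Suc n)
  then obtain F where F: "finite F" "card F = card E ^ n" "separated n F" by blast
  interpret normal "V (Suc n)" G by (rule V_normal)
  interpret N: normal "V n" G by (rule V_normal)
  have Ec: "e \<in> carrier G" if "e \<in> E" for e using that E by (auto simp: separated_def)
  have Fc: "e \<in> carrier G" if "e \<in> F" for e using that F by (auto simp: separated_def)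
  define \<phi> where "\<phi> = (\<lambda>(f, e). f \<otimes> e [^] (p ^ n))"
  have key: "f = f' \<and> e = e'" if fe: "f \<in> F" "f' \<in> F" "e \<in> E" "e' \<in> E"
    and eq: "V (Suc n) #> (f \<otimes> e [^] (p ^ n)) = V (Suc n) #> (f' \<otimes> e' [^] (p ^ n))" for f f' e e'
  proof -
    have c: "f \<in> carrier G" "f' \<in> carrier G" "e \<in> carrier G" "e' \<in> carrier G" using fe Ec Fc by auto
    have drop: "V n #> (g \<otimes> a [^] (p ^ n)) = V n #> g" if "g \<in> carrier G" "a \<in> carrier G" for g a
    proof -
      have "a [^] (p ^ n) \<in> V n" using V_pow_iter[of a 0 n] that by simp
      hence "g \<otimes> a [^] (p ^ n) \<otimes> inv g \<in> V n" using that V_conj by blast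
      thus ?thesis using N.rcos_eq_iff that by simp
    qed
    have "V n #> (f \<otimes> e [^] (p ^ n)) = V n #> (f' \<otimes> e' [^] (p ^ n))"
      using V_rcos_mono[OF eq] c by simp
    hence "f = f'" using drop c F(3) fe by (simp add: separated_def)
    have "V (Suc n) #> (inv f \<otimes> (f \<otimes> e [^] (p ^ n))) = V (Suc n) #> (inv f \<otimes> (f \<otimes> e' [^] (p ^ n)))"
      using eq c \<open>f = f'\<close> rcos_mult_cong[of "inv f" "inv f" "f \<otimes> e [^] (p ^ n)" "f \<otimes> e' [^] (p ^ n)"] by simp
    hence "V (Suc n) #> (e [^] (p ^ n)) = V (Suc n) #> (e' [^] (p ^ n))" using c by simp
    hence "e [^] (p ^ n) \<otimes> inv (e' [^] (p ^ n)) \<in> V (Suc n)" using rcos_eq_iff c by simp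
    hence "e [^] (p ^ n) \<otimes> (inv e') [^] (p ^ n) \<in> V (Suc n)" using c by (simp add: nat_pow_inv)
    moreover have "V (Suc n) #> ((e \<otimes> inv e') [^] (p ^ n)) = V (Suc n) #> (e [^] (p ^ n) \<otimes> (inv e') [^] (p ^ n))"
      using c by (intro V_pow_iter_mult) auto
    ultimately have "(e \<otimes> inv e') [^] (p ^ n) \<in> V (Suc n)"
      using rcos_mem_cong[of "(e \<otimes> inv e') [^] (p ^ n)" "e [^] (p ^ n) \<otimes> (inv e') [^] (p ^ n)"] c by simp
    hence "e \<otimes> inv e' \<in> V (Suc 0)" using c by (intro V_pow_iter_inj) auto
    hence "V (Suc 0) #> e = V (Suc 0) #> e'" using normal.rcos_eq_iff[OF V_normal] c by blast
    thus ?thesis using E(2) fe \<open>f = f'\<close> by (simp add: separated_def)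
  qed
  let ?E = "\<phi> ` (F \<times> E)"
  have "inj_on \<phi> (F \<times> E)" using key by (auto simp: inj_on_def \<phi>_def)
  hence "card ?E = card E ^ Suc n" using F by (simp add: card_image card_cartesian_product)
  moreover have "separated (Suc n) ?E" unfolding separated_def
  proof (intro conjI ballI impI)
    show "?E \<subseteq> carrier G" using Ec Fc by (auto simp: \<phi>_def)
    fix a b assume ab: "a \<in> ?E" "b \<in> ?E" "V (Suc n) #> a = V (Suc n) #> b"
    obtain f e where a: "f \<in> F" "e \<in> E" "a = f \<otimes> e [^] (p ^ n)" using ab by (auto simp: \<phi>_def)
    obtain f' e' where b: "f' \<in> F" "e' \<in> E" "b = f' \<otimes> e' [^] (p ^ n)" using ab by (auto simp: \<phi>_def)
    show "a = b" using key[OF a(1) b(1) a(2) b(2)] ab a b by simp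
  qed
  moreover have "finite ?E" using E F by simp
  ultimately show ?case by blast
qed

lemma card_cover_ge:
  assumes min: "minimal_generating_system G T d x"
    and F: "finite F" "F \<subseteq> carrier G" "carrier G \<subseteq> V n <#> F"
  shows "p ^ (d * n) \<le> card F"
proof -
  obtain E where E: "finite E" "card E = p ^ d" "separated (Suc 0) E"
    using separated_generators[OF min, of d] by blast
  obtain E' where E': "card E' = (p ^ d) ^ n" "separated n E'"
    using separated_powers[OF E(1,3), of n] E(2) by metis
  show ?thesis using card_separated_le[OF E'(2) F] E'(1) by (simp add: power_mult)
qed

end

section \<open>Index estimates from an approximation\<close>

lemma set_product_consistent:
  "set_product (G\<lparr>carrier := U\<rparr>) d H = set_product G d H"
  by (induction d) simp_all

lemma set_product_mono:
  "(\<And>k. k \<in> {1..d} \<Longrightarrow> A k \<subseteq> B k) \<Longrightarrow> set_product G d A \<subseteq> set_product G d B"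
  by (induction d) (simp_all add: mono_set_mult)

lemma (in group) set_product_subgroup:
  assumes "subgroup U G" "\<And>k. k \<in> {1..d} \<Longrightarrow> A k \<subseteq> U"
  shows "set_product G d A \<subseteq> U"
  using assms(2)
proof (induction d)
  case (Suc d)
  have "set_product G d A <#> A (Suc d) \<subseteq> U <#> U"
    using Suc by (intro mono_set_mult) auto
  thus ?case using subgroup_mult_id[OF assms(1)] by simp
qed (use subgroup.one_closed[OF assms(1)] in simp)

lemma lower_p_series_subset:
  "topspace T = carrier G \<Longrightarrow> lower_p_series p G T n \<subseteq> carrier G"
  using closure_of_subset_topspace[of T] by (cases n) auto

locale approximated = pro_p +
  fixes d j :: nat and x :: "nat \<Rightarrow> 'a" and \<xi> :: "nat \<Rightarrow> rat" and c :: nat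
  assumes approx: "lower_p_series_approximation p G T d j x \<xi> c"
begin

abbreviation "U \<equiv> lower_p_series p G T j"
abbreviation "GU \<equiv> G\<lparr>carrier := U\<rparr>"
abbreviation "TU \<equiv> subtopology T U"
abbreviation "L i \<equiv> approx_lower p G T d j x \<xi> c i"
abbreviation "M i \<equiv> approx_upper p G T d j x \<xi> c i"
abbreviation "fl k i \<equiv> nat \<lfloor>of_nat (i - j) * \<xi> k\<rfloor>"
abbreviation "start \<equiv> max 1 (max (j + 2 * c * d) (6 * c * d))"

lemma approxD:
  shows "uniformly_powerful p GU TU" "minimal_generating_system GU TU d x"
    and "i \<ge> start \<Longrightarrow> L i \<lhd> G" "i \<ge> start \<Longrightarrow> openin T (L i)"
    and "i \<ge> start \<Longrightarrow> M i \<lhd> G" "i \<ge> start \<Longrightarrow> openin T (M i)"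
    and "i \<ge> start \<Longrightarrow> L i \<subseteq> lower_p_series p G T i"
    and "i \<ge> start \<Longrightarrow> lower_p_series p G T i \<subseteq> M i"
    and "k \<in> {1..d} \<Longrightarrow> 1 / of_nat d \<le> \<xi> k" "k \<in> {1..d} \<Longrightarrow> l \<in> {1..d} \<Longrightarrow> k \<le> l \<Longrightarrow> \<xi> k \<le> \<xi> l"
  using approx unfolding lower_p_series_approximation_def Let_def by simp_all

lemma U_subset: "U \<subseteq> carrier G"
  by (rule lower_p_series_subset) simp

lemma U_uniform: "uniform GU TU p"
proof -
  have "pro_p_group p GU TU" using approxD(1) by (simp add: uniformly_powerful_def)
  hence "group GU" by (simp add: pro_p_group_def profinite_group_def topological_group_def)
  thus ?thesis
    using approxD(1) prime_p unfolding uniform_def uniform_axioms_def pro_p_def pro_p_axioms_def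
    by (auto simp: uniformly_powerful_def)
qed

lemma U_subgroup: "subgroup U G"
proof -
  interpret U: uniform GU TU p by (rule U_uniform)
  show ?thesis by (intro group_incl_imp_subgroup U_subset U.is_group)
qed

lemma x_mem: "k \<in> {1..d} \<Longrightarrow> x k \<in> U"
  using approxD(2) by (auto simp: minimal_generating_system_def topologically_generates_def)

text \<open>As a pro-\<open>p\<close> group \<open>U\<close> is compact in its own topology, and the
  ambient space is Hausdorff.\<close>

lemma U_closed: "closedin T U"
proof -
  interpret U: uniform GU TU p by (rule U_uniform)
  have "compactin T U" using U.compact U_subset by (simp add: compactin_subspace)
  thus ?thesis using hausdorff by (intro compactin_imp_closedin)
qed

lemma x_pow_mem: "k \<in> {1..d} \<Longrightarrow> x k [^] (n::nat) \<in> U"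
  using subgroup_int_pow_closed[OF U_subgroup x_mem, of k "int n"] by (simp add: int_pow_int)

lemma generate_pow_subset: "k \<in> {1..d} \<Longrightarrow> generate G {x k [^] (n::nat)} \<subseteq> U"
  using x_pow_mem by (intro generate_subgroup_incl U_subgroup) auto

lemma procyclic_pow_subset: "k \<in> {1..d} \<Longrightarrow> procyclic G T (x k [^] (n::nat)) \<subseteq> U"
  unfolding procyclic_def by (rule closure_of_minimal[OF generate_pow_subset U_closed])

lemma M_subset: "M i \<subseteq> U"
  unfolding approx_upper_def by (intro set_product_subgroup U_subgroup procyclic_pow_subset)

text \<open>Openness is read off from the approximation: the open subgroup \<open>M start\<close> is
  a product of procyclic subgroups of \<open>U\<close>.\<close>

lemma U_open: "openin T U"
  using approxD(5,6)[OF order_refl] M_subset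
  by (intro open_subgroup_mono[OF _ _ U_subgroup M_subset]) (auto intro: normal_imp_subgroup)

text \<open>Closures in \<open>U\<close> and in \<open>G\<close> agree here, so the factors of
  \<open>M i\<close> can be counted inside \<open>U\<close>, where the series \<open>U.V\<close>
  lives.\<close>

lemma procyclic_pow_GU:
  assumes "k \<in> {1..d}"
  shows "procyclic G T (x k [^] (n::nat)) \<subseteq> procyclic GU TU (x k [^] n)"
proof -
  have "generate GU {x k [^] n} = generate G {x k [^] n}"
    using x_pow_mem[OF assms] by (intro generate_consistent U_subgroup) auto
  moreover have "U \<inter> generate G {x k [^] n} = generate G {x k [^] n}"
    using generate_pow_subset[OF assms] by blast
  ultimately have "procyclic GU TU (x k [^] n) = U \<inter> procyclic G T (x k [^] n)"
    by (simp add: procyclic_def closure_of_subtopology)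
  thus ?thesis using procyclic_pow_subset[OF assms] by auto
qed

text \<open>The subgroup is the core of \<open>M i\<close> times the \<open>n\<close>-th term of the series of \<open>U\<close>; covers by
  finitely many cosets stand in for indices.\<close>

lemma index_lower_bound:
  "\<exists>a. \<forall>i\<ge>start. \<forall>n. \<exists>N. N \<lhd> G \<and> openin T N \<and> M i \<subseteq> N \<and>
    (\<forall>g\<in>carrier G. g [^] (p ^ (n + a)) \<in> N) \<and>
    (\<forall>F. finite F \<and> F \<subseteq> carrier G \<and> carrier G \<subseteq> N <#> F \<longrightarrow>
      p ^ (d * n) \<le> card F * (\<Prod>k\<in>{1..d}. p ^ (n - (fl k i - c))))"
proof -
  interpret U: uniform GU TU p by (rule U_uniform)
  obtain N0 where N0: "N0 \<lhd> G" "openin T N0" "N0 \<subseteq> U"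
    using open_normal_core[OF U_subgroup U_open] by metis
  \<comment> \<open>\<open>p^a\<close>-th powers carry \<open>G\<close> into \<open>N0\<close> and
    hence into \<open>U\<close>; this is the constant by which the exponent \<open>n + a\<close>
    exceeds \<open>n\<close>.\<close>
  obtain a where a: "order (G Mod N0) = p ^ a" using index_power[OF N0(1,2)] .
  have U_pow: "g [^] (p ^ a) \<in> U" if g: "g \<in> carrier G" for g
  proof -
    interpret normal N0 G by fact
    interpret Q: group "G Mod N0" by (rule factorgroup_is_group)
    have "(N0 #> g) [^]\<^bsub>G Mod N0\<^esub> (p ^ a) = \<one>\<^bsub>G Mod N0\<^esub>"
      using Q.pow_order_eq_1[of "N0 #> g"] a g by (simp add: carrier_FactGroup)
    hence "N0 #> (g [^] (p ^ a)) = N0" using g FactGroup_pow by simp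
    hence "g [^] (p ^ a) \<in> N0" using rcos_eq_self_iff g by simp
    thus ?thesis using N0 by blast
  qed
  have "\<exists>N. N \<lhd> G \<and> openin T N \<and> M i \<subseteq> N \<and>
    (\<forall>g\<in>carrier G. g [^] (p ^ (n + a)) \<in> N) \<and>
    (\<forall>F. finite F \<and> F \<subseteq> carrier G \<and> carrier G \<subseteq> N <#> F \<longrightarrow>
      p ^ (d * n) \<le> card F * (\<Prod>k\<in>{1..d}. p ^ (n - (fl k i - c))))" if i: "i \<ge> start" for i n
  proof -
    note Mn = approxD(5)[OF i] and Mo = approxD(6)[OF i]
    interpret Mi: normal "M i" G by (rule Mn)
    let ?V = "U.V n"
    \<comment> \<open>Truncated subtraction is harmless: if \<open>e\<close> exceeds
      \<open>n\<close>, the generator power already lies in the \<open>n\<close>-th term.\<close>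
    have n_le: "n \<le> e + (n - e)" for e :: nat by simp
    have VU: "?V \<subseteq> U" using U.V_subset[of n] by simp
    have sV: "subgroup ?V G" by (rule incl_subgroup[OF U_subgroup U.V_subgroup])
    interpret V: subgroup ?V G by (rule sV)
    \<comment> \<open>The series gives normality in \<open>U\<close>; normality in \<open>G\<close>
      comes from the core of \<open>N'\<close>. The core still contains \<open>M i\<close>, which is
      normal, and the required powers, whose conjugates are again powers.\<close>
    define N' where "N' = M i <#> ?V"
    have sN': "subgroup N' G" unfolding N'_def by (rule mult_norm_subgroup[OF Mn sV])
    have MN': "M i \<subseteq> N'"
    proof
      fix m assume m: "m \<in> M i"
      hence "m \<otimes> \<one> \<in> N'" unfolding N'_def by (intro set_mult_memI) auto
      thus "m \<in> N'" using m Mi.subset by auto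
    qed
    have VN': "?V \<subseteq> N'"
    proof
      fix v assume v: "v \<in> ?V"
      hence "\<one> \<otimes> v \<in> N'" unfolding N'_def using Mi.one_closed by (intro set_mult_memI) auto
      thus "v \<in> N'" using v V.subset by auto
    qed
    have oN': "openin T N'" by (rule open_subgroup_mono[OF Mi.is_subgroup Mo sN' MN'])
    obtain N where N: "N \<lhd> G" "openin T N" "N \<subseteq> N'"
      "\<And>y. y \<in> carrier G \<Longrightarrow> (\<And>g. g \<in> carrier G \<Longrightarrow> g \<otimes> y \<otimes> inv g \<in> N') \<Longrightarrow> y \<in> N"
      using open_normal_core[OF sN' oN'] by metis
    have "M i \<subseteq> N"
    proof
      fix m assume m: "m \<in> M i"
      show "m \<in> N" using m Mi.subset Mi.inv_op_closed2[OF _ m] MN' by (intro N(4)) auto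
    qed
    moreover have powN': "g [^] (p ^ (n + a)) \<in> N'" if g: "g \<in> carrier G" for g
    proof -
      have "(g [^] (p ^ a)) [^]\<^bsub>GU\<^esub> (p ^ n) \<in> ?V"
        using U.V_pow_iter[of "g [^] (p ^ a)" 0 n] U_pow[OF g] by simp
      hence "(g [^] (p ^ a)) [^] (p ^ n) \<in> ?V" by (simp flip: nat_pow_consistent)
      thus ?thesis using VN' g by (auto simp: nat_pow_pow power_add mult.commute)
    qed
    have "g [^] (p ^ (n + a)) \<in> N" if g: "g \<in> carrier G" for g
    proof (rule N(4))
      fix h assume h: "h \<in> carrier G"
      have "(h \<otimes> g \<otimes> inv h) [^] k = h \<otimes> g [^] k \<otimes> inv h" for k :: nat
        using h g by (induction k) (simp_all add: m_assoc)
      thus "h \<otimes> g [^] (p ^ (n + a)) \<otimes> inv h \<in> N'"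
        using powN'[of "h \<otimes> g \<otimes> inv h"] h g by simp
    qed (use g in simp)
    moreover have "p ^ (d * n) \<le> card F * (\<Prod>k\<in>{1..d}. p ^ (n - (fl k i - c)))"
      if F: "finite F" "F \<subseteq> carrier G" "carrier G \<subseteq> N <#> F" for F
    proof -
      interpret VU: normal ?V GU by (rule U.V_normal)
      \<comment> \<open>The \<open>p^n\<close>-th power of \<open>x k\<close> lies in the
        \<open>n\<close>-th term, so modulo \<open>?V\<close> the \<open>k\<close>-th factor of
        \<open>M i\<close> has at most \<open>p ^ (n - (fl k i - c))\<close> elements.\<close>
      have "\<exists>E. finite E \<and> E \<subseteq> carrier GU \<and> card E \<le> (\<Prod>k\<in>{1..d}. p ^ (n - (fl k i - c))) \<and>
        set_product GU d (\<lambda>k. procyclic GU TU (x k [^] (p ^ (fl k i - c)))) \<subseteq> ?V <#>\<^bsub>GU\<^esub> E"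
      proof (rule U.set_product_cover[OF U.V_normal U.V_open])
        fix k assume k: "k \<in> {1..d}"
        have y: "x k [^] (p ^ (fl k i - c)) \<in> carrier GU" using x_pow_mem[OF k] by simp
        have "x k \<in> U.V 0" using x_mem[OF k] by simp
        hence "x k [^]\<^bsub>GU\<^esub> (p ^ ((fl k i - c) + (n - (fl k i - c)))) \<in> U.V ((fl k i - c) + (n - (fl k i - c)))"
          using U.V_pow_iter[of "x k" 0] by simp
        hence "x k [^]\<^bsub>GU\<^esub> (p ^ ((fl k i - c) + (n - (fl k i - c)))) \<in> ?V"
          using U.V_mono[OF n_le[of "fl k i - c"]] by blast
        hence "x k [^] (p ^ (fl k i - c) * p ^ (n - (fl k i - c))) \<in> ?V"
          by (simp add: power_add flip: nat_pow_consistent)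
        hence "(x k [^] (p ^ (fl k i - c))) [^] (p ^ (n - (fl k i - c))) \<in> ?V"
          using x_mem[OF k] U_subset by (simp add: nat_pow_pow subsetD)
        thus "x k [^] (p ^ (fl k i - c)) \<in> carrier GU \<and> 0 < p ^ (n - (fl k i - c)) \<and>
          (x k [^] (p ^ (fl k i - c))) [^]\<^bsub>GU\<^esub> (p ^ (n - (fl k i - c))) \<in> ?V"
          using y prime_gt_0_nat[OF prime_p] by (simp flip: nat_pow_consistent)
      qed
      then obtain E where E: "finite E" "E \<subseteq> U" "card E \<le> (\<Prod>k\<in>{1..d}. p ^ (n - (fl k i - c)))"
        "set_product G d (\<lambda>k. procyclic GU TU (x k [^] (p ^ (fl k i - c)))) \<subseteq> ?V <#> E"
        by (auto simp: set_product_consistent)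
      have "M i \<subseteq> set_product G d (\<lambda>k. procyclic GU TU (x k [^] (p ^ (fl k i - c))))"
        unfolding approx_upper_def by (intro set_product_mono procyclic_pow_GU)
      hence ME: "M i \<subseteq> ?V <#> E" using E by blast
      \<comment> \<open>An element of \<open>U\<close> is \<open>m v f\<close> with
        \<open>m \<in> M i\<close>, \<open>v \<in> ?V\<close>, \<open>f \<in> F\<close>, and then
        \<open>f\<close> lies in \<open>U\<close> too. Replacing \<open>m\<close> by its
        representative \<open>e \<in> E\<close> and moving \<open>v\<close> past \<open>e\<close>
        covers \<open>U\<close> by cosets of \<open>?V\<close>.\<close>
      let ?F = "E <#> (F \<inter> U)"
      have cov: "carrier GU \<subseteq> ?V <#>\<^bsub>GU\<^esub> ?F"
      proof
        fix u assume "u \<in> carrier GU"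
        hence u: "u \<in> U" "u \<in> carrier G" using U_subset by auto
        then obtain g f where gf: "g \<in> N" "f \<in> F" "u = g \<otimes> f" using F by (blast elim: set_mult_memE)
        then obtain m v where mv: "m \<in> M i" "v \<in> ?V" "g = m \<otimes> v"
          using N(3) unfolding N'_def by (blast elim: set_mult_memE)
        obtain w e where we: "w \<in> ?V" "e \<in> E" "m = w \<otimes> e" using ME mv by (blast elim: set_mult_memE)
        have inU: "m \<in> U" "v \<in> U" "w \<in> U" "e \<in> U" using mv we M_subset VU E by auto
        have ce: "m \<in> carrier G" "v \<in> carrier G" "w \<in> carrier G" "e \<in> carrier G" "f \<in> carrier G"
          using inU U_subset gf F by auto
        have "inv (m \<otimes> v) \<otimes> u \<in> U"
          using inU u subgroup.m_closed[OF U_subgroup] subgroup.m_inv_closed[OF U_subgroup] by blast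
        hence "f \<in> U" using gf mv ce by simp
        have "e \<otimes> v \<otimes> inv e \<in> ?V"
          using VU.inv_op_closed2[of e v] inU mv U_subgroup by simp
        hence "w \<otimes> (e \<otimes> v \<otimes> inv e) \<in> ?V" using we by blast
        moreover have "e \<otimes> f \<in> ?F" using we gf \<open>f \<in> U\<close> by (intro set_mult_memI) auto
        ultimately have "w \<otimes> (e \<otimes> v \<otimes> inv e) \<otimes> (e \<otimes> f) \<in> ?V <#> ?F" by (rule set_mult_memI)
        moreover have "w \<otimes> (e \<otimes> v \<otimes> inv e) \<otimes> (e \<otimes> f) = u"
          unfolding gf(3) mv(3) we(3) using ce by (simp add: m_assoc)
        ultimately show "u \<in> ?V <#>\<^bsub>GU\<^esub> ?F" by simp
      qed
      have fin: "finite ?F" and le: "card ?F \<le> card E * card (F \<inter> U)"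
        using card_set_mult_le[of E "F \<inter> U" G] E F by auto
      have "?F \<subseteq> U <#> U" using E by (intro mono_set_mult) auto
      hence "?F \<subseteq> carrier GU" using subgroup_mult_id[OF U_subgroup] by simp
      hence "p ^ (d * n) \<le> card ?F" using fin cov by (intro U.card_cover_ge[OF approxD(2)])
      also have "\<dots> \<le> card E * card F"
        using le card_mono[of F "F \<inter> U"] F by (meson Int_lower1 le_trans mult_le_mono2)
      also have "\<dots> \<le> card F * (\<Prod>k\<in>{1..d}. p ^ (n - (fl k i - c)))"
        using E by (simp add: mult.commute)
      finally show ?thesis .
    qed
    ultimately show ?thesis using N(1,2) by blast
  qed
  thus ?thesis by (intro exI[of _ a] allI impI)
qed

text \<open>Finitely many translates of \<open>M start\<close> cover \<open>G\<close>, and their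
  number gives \<open>C\<close>, independent of \<open>i\<close>, \<open>m\<close> and
  \<open>N\<close>. By definition \<open>M start\<close> is a product of procyclic subgroups; modulo
  \<open>N\<close> the order of \<open>x k\<close> divides both \<open>p ^ m\<close>, by the power
  condition, and \<open>p ^ (fl k i + c)\<close>, by \<open>L i \<subseteq> N\<close>.\<close>

lemma index_upper_bound:
  "\<exists>C. \<forall>i\<ge>start. \<forall>m N. N \<lhd> G \<and> openin T N \<and> L i \<subseteq> N \<and>
       (\<forall>g\<in>carrier G. g [^] (p ^ m) \<in> N) \<longrightarrow>
       (\<exists>F. finite F \<and> F \<subseteq> carrier G \<and> carrier G \<subseteq> N <#> F \<and>
         card F \<le> C * (\<Prod>k\<in>{1..d}. p ^ min m (fl k i + c)))"
proof -
  note Mn = approxD(5)[OF order_refl] and Mo = approxD(6)[OF order_refl]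
  have sM: "subgroup (M start) G" using Mn normal_imp_subgroup by blast
  obtain R where R: "finite R" "R \<subseteq> carrier G" "carrier G \<subseteq> M start <#> R"
    using open_subgroup_finite_index[OF sM Mo] .
  have xc: "x k \<in> carrier G" if "k \<in> {1..d}" for k using x_mem[OF that] U_subset by blast
  have bound: "\<exists>F. finite F \<and> F \<subseteq> carrier G \<and> carrier G \<subseteq> N <#> F \<and>
         card F \<le> Suc (card R) * (\<Prod>k\<in>{1..d}. p ^ min m (fl k i + c))"
    if i: "i \<ge> start" and N: "N \<lhd> G" "openin T N" "L i \<subseteq> N"
      and pw: "\<And>g. g \<in> carrier G \<Longrightarrow> g [^] (p ^ m) \<in> N" for i m N
  proof -
    interpret normal N G by fact
    \<comment> \<open>This element is a product in \<open>L i\<close> whose other factors are the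
      identity.\<close>
    have LN: "x k [^] (p ^ (fl k i + c)) \<in> N" if k: "k \<in> {1..d}" for k
    proof -
      let ?P = "\<lambda>k. procyclic G T (x k [^] (p ^ (fl k i + c)))"
      have inP: "g \<in> procyclic G T g" if "g \<in> carrier G" for g
        using that closure_of_subset[of "generate G {g}" T] generate.incl[of g "{g}" G]
          generate_incl[of "{g}"] by (auto simp: procyclic_def)
      have oneP: "\<one> \<in> procyclic G T g" if "g \<in> carrier G" for g
        using that closure_of_subset[of "generate G {g}" T] generate.one[of G "{g}"]
          generate_incl[of "{g}"] by (auto simp: procyclic_def)
      have "x k [^] (p ^ (fl k i + c)) \<in> set_product G e ?P" if "k \<le> e" "e \<le> d" for e
        using that
      proof (induction e)
        case (Suc e)
        show ?case
        proof (cases "k = Suc e")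
          case True
          have "\<one> \<in> set_product G e' ?P" if "e' \<le> d" for e'
            using that
          proof (induction e')
            case (Suc e')
            have "\<one> \<otimes> \<one> \<in> set_product G (Suc e') ?P"
              unfolding set_product.simps using Suc xc by (intro set_mult_memI oneP) auto
            thus ?case by simp
          qed simp
          hence "\<one> \<otimes> x k [^] (p ^ (fl k i + c)) \<in> set_product G (Suc e) ?P"
            unfolding set_product.simps using Suc.prems True xc[OF k] by (intro set_mult_memI) (auto intro: inP)
          thus ?thesis using xc[OF k] by simp
        next
          case False
          have "x k [^] (p ^ (fl k i + c)) \<otimes> \<one> \<in> set_product G (Suc e) ?P"
            unfolding set_product.simps using Suc False xc by (intro set_mult_memI oneP) auto
          thus ?thesis using xc[OF k] by simp
        qed
      qed (use k in simp)
      from this[of d] show ?thesis using k N(3) by (auto simp: approx_lower_def)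
    qed
    let ?e = "\<lambda>k. p ^ (fl k start - c)"
    have "\<exists>F. finite F \<and> F \<subseteq> carrier G \<and> card F \<le> (\<Prod>k\<in>{1..d}. p ^ min m (fl k i + c)) \<and>
      set_product G d (\<lambda>k. procyclic G T (x k [^] ?e k)) \<subseteq> N <#> F"
    proof (rule set_product_cover[OF N(1,2)])
      fix k assume k: "k \<in> {1..d}"
      have "x k [^] (p ^ min m (fl k i + c)) \<in> N"
        using LN[OF k] pw[OF xc[OF k]] by (simp add: min_def)
      hence "(x k [^] (p ^ min m (fl k i + c))) [^] int (?e k) \<in> N"
        by (rule subgroup_int_pow_closed[OF is_subgroup])
      hence "(x k [^] ?e k) [^] (p ^ min m (fl k i + c)) \<in> N"
        unfolding int_pow_int using xc[OF k] by (simp add: nat_pow_pow mult.commute)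
      thus "x k [^] ?e k \<in> carrier G \<and> 0 < p ^ min m (fl k i + c) \<and>
        (x k [^] ?e k) [^] (p ^ min m (fl k i + c)) \<in> N"
        using xc[OF k] prime_gt_0_nat[OF prime_p] by simp
    qed
    then obtain F where F: "finite F" "F \<subseteq> carrier G" "card F \<le> (\<Prod>k\<in>{1..d}. p ^ min m (fl k i + c))"
      "M start \<subseteq> N <#> F" unfolding approx_upper_def by blast
    have "carrier G \<subseteq> (N <#> F) <#> R"
      using R(3) mono_set_mult[OF F(4) order_refl, of G R] by blast
    hence "carrier G \<subseteq> N <#> (F <#> R)" using set_mult_assoc[OF subset F(2) R(2)] by simp
    moreover have "card (F <#> R) \<le> Suc (card R) * (\<Prod>k\<in>{1..d}. p ^ min m (fl k i + c))"
    proof -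
      have "card (F <#> R) \<le> card F * card R" by (rule card_set_mult_le(2)[OF F(1) R(1)])
      also have "\<dots> \<le> (\<Prod>k\<in>{1..d}. p ^ min m (fl k i + c)) * Suc (card R)"
        by (intro mult_le_mono F(3)) simp
      finally show ?thesis by (simp add: mult.commute)
    qed
    moreover have "F <#> R \<subseteq> carrier G" using F R by (intro setmult_subset_G)
    ultimately show ?thesis using card_set_mult_le(1)[OF F(1) R(1)] by blast
  qed
  show ?thesis
  proof (intro exI[of _ "Suc (card R)"] allI impI, elim conjE)
    fix i m N
    assume "start \<le> i" "N \<lhd> G" "openin T N" "L i \<subseteq> N" "\<forall>g\<in>carrier G. g [^] (p ^ m) \<in> N"
    thus "\<exists>F. finite F \<and> F \<subseteq> carrier G \<and> carrier G \<subseteq> N <#> F \<and>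
         card F \<le> Suc (card R) * (\<Prod>k\<in>{1..d}. p ^ min m (fl k i + c))"
      using bound[of i N m] by simp
  qed
qed

end

section \<open>Comparing two approximations\<close>

text \<open>The two approximations meet in the inclusions of the lower subgroup of one and the upper
  subgroup of the other around the same term of the lower \<open>p\<close>-series. So the subgroup
  built from the primed data satisfies the conditions of the upper bound for the unprimed data, with
  \<open>m = n + a\<close>; comparing exponents of \<open>p\<close> gives the inequality.\<close>

lemma approximations_exponent_bound:
  fixes p d j j' c c' :: nat and G :: "('a, 'b) monoid_scheme" and T :: "'a topology"
    and x x' :: "nat \<Rightarrow> 'a" and \<xi> \<xi>' :: "nat \<Rightarrow> rat"
  assumes "prime p" "pro_p_group p G T"
    and "lower_p_series_approximation p G T d j x \<xi> c"
    and "lower_p_series_approximation p G T d j' x' \<xi>' c'"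
  shows "\<exists>a b I. \<forall>i\<ge>I. \<forall>n. d * n \<le> b
    + (\<Sum>k\<in>{1..d}. min (n + a) (nat \<lfloor>of_nat (i - j) * \<xi> k\<rfloor> + c))
    + (\<Sum>k\<in>{1..d}. n - (nat \<lfloor>of_nat (i - j') * \<xi>' k\<rfloor> - c'))"
proof -
  have grp: "group G" using assms(2) by (simp add: pro_p_group_def profinite_group_def topological_group_def)
  have pp: "pro_p G T p" using grp assms(1,2) by (simp add: pro_p_def pro_p_axioms_def)
  interpret A: approximated G T p d j x \<xi> c
    using pp assms(3) by (simp add: approximated_def approximated_axioms_def)
  interpret B: approximated G T p d j' x' \<xi>' c'
    using pp assms(4) by (simp add: approximated_def approximated_axioms_def)
  obtain C where C: "\<forall>i\<ge>A.start. \<forall>m N. N \<lhd> G \<and> openin T N \<and> A.L i \<subseteq> N \<and>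
       (\<forall>g\<in>carrier G. g [^]\<^bsub>G\<^esub> (p ^ m) \<in> N) \<longrightarrow>
       (\<exists>F. finite F \<and> F \<subseteq> carrier G \<and> carrier G \<subseteq> N <#>\<^bsub>G\<^esub> F \<and>
         card F \<le> C * (\<Prod>k\<in>{1..d}. p ^ min m (A.fl k i + c)))"
    using A.index_upper_bound by blast
  obtain a where a: "\<forall>i\<ge>B.start. \<forall>n. \<exists>N. N \<lhd> G \<and> openin T N \<and> B.M i \<subseteq> N \<and>
    (\<forall>g\<in>carrier G. g [^]\<^bsub>G\<^esub> (p ^ (n + a)) \<in> N) \<and>
    (\<forall>F. finite F \<and> F \<subseteq> carrier G \<and> carrier G \<subseteq> N <#>\<^bsub>G\<^esub> F \<longrightarrow>
      p ^ (d * n) \<le> card F * (\<Prod>k\<in>{1..d}. p ^ (n - (B.fl k i - c'))))"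
    using B.index_lower_bound by blast
  have p1: "p > 1" using assms(1) prime_gt_1_nat by blast
  have "d * n \<le> C + (\<Sum>k\<in>{1..d}. min (n + a) (A.fl k i + c)) + (\<Sum>k\<in>{1..d}. n - (B.fl k i - c'))"
    if i: "i \<ge> max A.start B.start" for i n
  proof -
    have iA: "i \<ge> A.start" and iB: "i \<ge> B.start" using i by (simp_all only: max.bounded_iff)
    have "\<exists>N. N \<lhd> G \<and> openin T N \<and> B.M i \<subseteq> N \<and>
      (\<forall>g\<in>carrier G. g [^]\<^bsub>G\<^esub> (p ^ (n + a)) \<in> N) \<and>
      (\<forall>F. finite F \<and> F \<subseteq> carrier G \<and> carrier G \<subseteq> N <#>\<^bsub>G\<^esub> F \<longrightarrow>
        p ^ (d * n) \<le> card F * (\<Prod>k\<in>{1..d}. p ^ (n - (B.fl k i - c'))))"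
      using a[THEN spec, THEN mp, OF iB, THEN spec, of n] .
    then obtain N where N: "N \<lhd> G" "openin T N" "B.M i \<subseteq> N"
      "\<forall>g\<in>carrier G. g [^]\<^bsub>G\<^esub> (p ^ (n + a)) \<in> N"
      and N5: "\<forall>F. finite F \<and> F \<subseteq> carrier G \<and> carrier G \<subseteq> N <#>\<^bsub>G\<^esub> F \<longrightarrow>
        p ^ (d * n) \<le> card F * (\<Prod>k\<in>{1..d}. p ^ (n - (B.fl k i - c')))"
      by (elim exE conjE) (rule that)
    have "A.L i \<subseteq> N" using A.approxD(7)[OF iA] B.approxD(8)[OF iB] N(3) by blast
    then obtain F where F: "finite F" "F \<subseteq> carrier G" "carrier G \<subseteq> N <#>\<^bsub>G\<^esub> F"
      "card F \<le> C * (\<Prod>k\<in>{1..d}. p ^ min (n + a) (A.fl k i + c))"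
      using C[rule_format, OF iA, of N "n + a"] N(1,2,4) by blast
    have "p ^ (d * n) \<le> card F * (\<Prod>k\<in>{1..d}. p ^ (n - (B.fl k i - c')))" using N5 F(1-3) by simp
    also have "\<dots> \<le> C * (\<Prod>k\<in>{1..d}. p ^ min (n + a) (A.fl k i + c)) * (\<Prod>k\<in>{1..d}. p ^ (n - (B.fl k i - c')))"
      by (intro mult_le_mono F(4) order_refl)
    \<comment> \<open>\<open>C \<le> p ^ C\<close> moves the multiplicative constant into the
      exponent.\<close>
    also have "\<dots> \<le> p ^ C * (\<Prod>k\<in>{1..d}. p ^ min (n + a) (A.fl k i + c)) * (\<Prod>k\<in>{1..d}. p ^ (n - (B.fl k i - c')))"
      using power_gt_expt[of p C] p1 by (intro mult_le_mono order_refl) simp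
    also have "\<dots> = p ^ (C + (\<Sum>k\<in>{1..d}. min (n + a) (A.fl k i + c)) + (\<Sum>k\<in>{1..d}. n - (B.fl k i - c')))"
      by (simp only: power_add power_sum)
    finally show ?thesis using p1 by (simp only: power_increasing_iff)
  qed
  thus ?thesis by blast
qed

text \<open>Subtracting the truncated differences from \<open>d * n\<close> leaves, up to bounded
  errors, the sum of \<open>min n (i * \<xi>' k)\<close>. The exponent bound thus compares this sum
  with the one for \<open>\<xi>\<close>; along \<open>n / i = t\<close> both grow linearly in
  \<open>i\<close>, and the errors become negligible.\<close>

lemma approximations_min_sum_le:
  fixes p d j j' c c' :: nat and G :: "('a, 'b) monoid_scheme" and T :: "'a topology"
    and x x' :: "nat \<Rightarrow> 'a" and \<xi> \<xi>' :: "nat \<Rightarrow> rat"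
  assumes "prime p" "pro_p_group p G T"
    and \<xi>: "lower_p_series_approximation p G T d j x \<xi> c"
    and \<xi>': "lower_p_series_approximation p G T d j' x' \<xi>' c'"
    and t: "t > 0"
  shows "(\<Sum>k\<in>{1..d}. min t (\<xi>' k)) \<le> (\<Sum>k\<in>{1..d}. min t (\<xi> k))"
proof (rule ccontr)
  assume neg: "\<not> ?thesis"
  define \<delta> where "\<delta> = (\<Sum>k\<in>{1..d}. min t (\<xi>' k)) - (\<Sum>k\<in>{1..d}. min t (\<xi> k))"
  have \<delta>: "\<delta> > 0" using neg by (simp add: \<delta>_def)
  have pos: "\<xi> k \<ge> 0" "\<xi>' k \<ge> 0" if "k \<in> {1..d}" for k
  proof -
    have "1 / of_nat d \<le> \<xi> k" "1 / of_nat d \<le> \<xi>' k"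
      using \<xi> \<xi>' that unfolding lower_p_series_approximation_def Let_def by auto
    moreover have "0 \<le> 1 / (of_nat d :: rat)" by simp
    ultimately show "\<xi> k \<ge> 0" "\<xi>' k \<ge> 0" by linarith+
  qed
  obtain a b I where bound: "\<And>i n. i \<ge> I \<Longrightarrow> d * n \<le> b
    + (\<Sum>k\<in>{1..d}. min (n + a) (nat \<lfloor>of_nat (i - j) * \<xi> k\<rfloor> + c))
    + (\<Sum>k\<in>{1..d}. n - (nat \<lfloor>of_nat (i - j') * \<xi>' k\<rfloor> - c'))"
    using approximations_exponent_bound[OF assms(1-4)] by blast
  \<comment> \<open>With \<open>t = u / v\<close>, the choice \<open>i = v * s\<close> and
    \<open>n = u * s\<close> makes \<open>n / i\<close> exactly \<open>t\<close> for every
    \<open>s\<close>.\<close>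
  obtain r q where rq: "quotient_of t = (r, q)" by fastforce
  define u where "u = nat r" define v where "v = nat q"
  have q: "q > 0" using quotient_of_denom_pos[OF rq] .
  have tq: "t = of_int r / of_int q" using quotient_of_div[OF rq] .
  hence "r > 0" using t q by (simp add: zero_less_divide_iff)
  hence uv: "of_nat u = of_int r" "of_nat v = of_int q" "v > 0" using q by (simp_all add: u_def v_def)
  have tv: "of_nat v * t = of_nat u" unfolding uv tq using q by simp
  \<comment> \<open>The total error, independent of \<open>s\<close>. Each term of the first sum
    costs \<open>a + c\<close>; each term of the second costs \<open>j' * \<xi>' k\<close> for the
    shift by \<open>j'\<close>, 1 for the floor and \<open>c'\<close>.\<close>
  define K :: rat where "K = of_nat b + of_nat d * (of_nat a + of_nat c)
     + (\<Sum>k\<in>{1..d}. of_nat j' * \<xi>' k + 1 + of_nat c')"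
  have est: "of_nat v * of_nat s * \<delta> \<le> K" if s: "s \<ge> I + j + j'" for s
  proof -
    let ?i = "v * s" and ?n = "u * s"
    have "s \<le> v * s" using uv by simp
    hence "I + j + j' \<le> ?i" using s by (rule le_trans[rotated])
    hence i: "?i \<ge> I" "?i \<ge> j" "?i \<ge> j'" by linarith+
    have scale: "min (of_nat ?n) (of_nat ?i * y) = of_nat ?i * min t y" for y :: rat
    proof -
      have e: "of_nat ?n = of_nat ?i * t" using tv by (simp add: mult_ac)
      show ?thesis unfolding e by (simp add: min_mult_distrib_left)
    qed
    have 1: "of_nat (min (?n + a) (nat \<lfloor>of_nat (?i - j) * \<xi> k\<rfloor> + c))
        \<le> of_nat ?i * min t (\<xi> k) + of_nat a + of_nat c" if k: "k \<in> {1..d}" for k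
    proof -
      have "of_nat (nat \<lfloor>of_nat (?i - j) * \<xi> k\<rfloor>) \<le> of_nat (?i - j) * \<xi> k"
        using pos(1)[OF k] by (simp add: of_nat_nat)
      also have "\<dots> \<le> of_nat ?i * \<xi> k" using pos(1)[OF k] by (intro mult_right_mono of_nat_mono) auto
      finally show ?thesis unfolding scale[symmetric] of_nat_min of_nat_add
        by (simp add: min_def del: of_nat_mult)
    qed
    have 2: "of_nat (?n - (nat \<lfloor>of_nat (?i - j') * \<xi>' k\<rfloor> - c'))
        \<le> of_nat ?n - of_nat ?i * min t (\<xi>' k) + (of_nat j' * \<xi>' k + 1 + of_nat c')" if k: "k \<in> {1..d}" for k
    proof -
      have diff: "of_nat (m - l) = max 0 (of_nat m - of_nat l :: rat)" for m l :: nat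
        by (cases "l \<le> m") (auto simp: of_nat_diff)
      let ?f = "nat \<lfloor>of_nat (?i - j') * \<xi>' k\<rfloor>"
      have "of_nat (?i - j') * \<xi>' k < of_int \<lfloor>of_nat (?i - j') * \<xi>' k\<rfloor> + 1" by linarith
      also have "\<dots> = of_nat ?f + 1" using pos(2)[OF k] by (simp add: of_nat_nat)
      finally have "of_nat ?i * \<xi>' k \<le> of_nat ?f + 1 + of_nat j' * \<xi>' k"
        using i by (simp add: of_nat_diff algebra_simps)
      moreover have "of_nat ?f \<le> of_nat (?f - c') + (of_nat c' :: rat)"
        by (metis of_nat_add of_nat_mono le_diff_conv order_refl)
      moreover have "0 \<le> of_nat j' * \<xi>' k" using pos(2)[OF k] by simp
      moreover have "of_nat (?n - (?f - c')) = max 0 (of_nat ?n - (of_nat (?f - c') :: rat))"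
        by (rule diff)
      ultimately show ?thesis unfolding scale[symmetric] by (simp add: min_def max_def split: if_splits)
    qed
    have "of_nat (d * ?n) \<le> (of_nat (b
      + (\<Sum>k\<in>{1..d}. min (?n + a) (nat \<lfloor>of_nat (?i - j) * \<xi> k\<rfloor> + c))
      + (\<Sum>k\<in>{1..d}. ?n - (nat \<lfloor>of_nat (?i - j') * \<xi>' k\<rfloor> - c'))) :: rat)"
      using bound[OF i(1), of ?n] by (simp only: of_nat_le_iff)
    also have "\<dots> = of_nat b
      + (\<Sum>k\<in>{1..d}. of_nat (min (?n + a) (nat \<lfloor>of_nat (?i - j) * \<xi> k\<rfloor> + c)))
      + (\<Sum>k\<in>{1..d}. of_nat (?n - (nat \<lfloor>of_nat (?i - j') * \<xi>' k\<rfloor> - c')))"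
      by (simp only: of_nat_add of_nat_sum)
    also have "\<dots> \<le> of_nat b + (\<Sum>k\<in>{1..d}. of_nat ?i * min t (\<xi> k) + of_nat a + of_nat c)
      + (\<Sum>k\<in>{1..d}. of_nat ?n - of_nat ?i * min t (\<xi>' k) + (of_nat j' * \<xi>' k + 1 + of_nat c'))"
      by (intro add_mono sum_mono 1 2 order_refl)
    also have "\<dots> = K + of_nat (d * ?n) - of_nat ?i * \<delta>"
      by (simp add: K_def \<delta>_def sum.distrib sum_subtractf algebra_simps flip: sum_distrib_left)
    finally show ?thesis by simp
  qed
  obtain s0 :: nat where s0: "K / (of_nat v * \<delta>) < of_nat s0" using reals_Archimedean2 by metis
  define s where "s = s0 + (I + j + j')"
  have "K < of_nat s0 * (of_nat v * \<delta>)" using s0 \<delta> uv by (simp add: pos_divide_less_eq)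
  also have "\<dots> \<le> of_nat s * (of_nat v * \<delta>)" using \<delta> by (intro mult_right_mono) (auto simp: s_def)
  finally show False using est[of s] by (simp add: s_def mult_ac)
qed

text \<open>At the first disagreement, say \<open>f k < g k\<close>, take \<open>t = g k\<close>.
  Earlier terms agree; from \<open>k\<close> on, sortedness truncates every term of \<open>g\<close>
  to exactly \<open>t\<close>, which no term of \<open>f\<close> exceeds, and the
  \<open>k\<close>-th one stays strictly below. The sums would differ.\<close>

lemma sorted_eq_of_min_sum_eq:
  fixes \<xi> \<xi>' :: "nat \<Rightarrow> rat"
  assumes mono: "\<And>k l. k \<in> {1..d} \<Longrightarrow> l \<in> {1..d} \<Longrightarrow> k \<le> l \<Longrightarrow> \<xi> k \<le> \<xi> l"
      "\<And>k l. k \<in> {1..d} \<Longrightarrow> l \<in> {1..d} \<Longrightarrow> k \<le> l \<Longrightarrow> \<xi>' k \<le> \<xi>' l"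
    and pos: "\<And>k. k \<in> {1..d} \<Longrightarrow> 0 < \<xi> k" "\<And>k. k \<in> {1..d} \<Longrightarrow> 0 < \<xi>' k"
    and eq: "\<And>t. t > 0 \<Longrightarrow> (\<Sum>k\<in>{1..d}. min t (\<xi> k)) = (\<Sum>k\<in>{1..d}. min t (\<xi>' k))"
  shows "k \<in> {1..d} \<Longrightarrow> \<xi> k = \<xi>' k"
proof (induction k rule: less_induct)
  case (less k)
  have aux: "\<not> f k < g k"
    if m: "\<And>k l. k \<in> {1..d} \<Longrightarrow> l \<in> {1..d} \<Longrightarrow> k \<le> l \<Longrightarrow> g k \<le> g l"
      and e: "\<And>t. t > 0 \<Longrightarrow> (\<Sum>k\<in>{1..d}. min t (f k)) = (\<Sum>k\<in>{1..d}. min t (g k))"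
      and l: "\<And>l. l < k \<Longrightarrow> l \<in> {1..d} \<Longrightarrow> f l = g l" and p: "0 < g k" for f g :: "nat \<Rightarrow> rat"
  proof
    assume fg: "f k < g k"
    have "(\<Sum>l\<in>{1..d}. min (g k) (f l)) < (\<Sum>l\<in>{1..d}. min (g k) (g l))"
    proof (rule sum_strict_mono_ex1)
      show "\<forall>i\<in>{1..d}. min (g k) (f i) \<le> min (g k) (g i)"
      proof
        fix i assume i: "i \<in> {1..d}"
        show "min (g k) (f i) \<le> min (g k) (g i)"
          using l[of i] m[of k i] i less.prems by (cases "i < k") auto
      qed
      show "\<exists>i\<in>{1..d}. min (g k) (f i) < min (g k) (g i)"
        using less.prems fg by (intro bexI[of _ k]) auto
    qed simp
    thus False using e[OF p] by simp
  qed
  have "\<not> \<xi> k < \<xi>' k"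
    using less.IH less.prems by (intro aux mono eq pos) auto
  moreover have "\<not> \<xi>' k < \<xi> k"
    using less.IH less.prems by (intro aux mono eq[symmetric] pos) auto
  ultimately show ?case by simp
qed

theorem corollary1p4:
  fixes p d j j' c c' :: nat
    and G :: "('a, 'b) monoid_scheme" and T :: "'a topology"
    and x x' :: "nat \<Rightarrow> 'a" and \<xi> \<xi>' :: "nat \<Rightarrow> rat"
  assumes "prime p"
    and "pro_p_group p G T"
    and "padic_analytic_group p d G T"
    and "lower_p_series_approximation p G T d j x \<xi> c"
    and "lower_p_series_approximation p G T d j' x' \<xi>' c'"
  shows "\<forall>k\<in>{1..d}. \<xi> k = \<xi>' k"
proof
  fix k assume k: "k \<in> {1..d}"
  have D: "0 < f l" "l \<le> m \<Longrightarrow> f l \<le> f m"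
    if "lower_p_series_approximation p G T d i y f b" and l: "l \<in> {1..d}" "m \<in> {1..d}"
    for i y f b l m
  proof -
    have "1 / of_nat d \<le> f l" using that unfolding lower_p_series_approximation_def Let_def by auto
    moreover have "0 < 1 / (of_nat d :: rat)" using l by simp
    ultimately show "0 < f l" by linarith
    show "f l \<le> f m" if "l \<le> m"
      using that \<open>lower_p_series_approximation p G T d i y f b\<close> l
      unfolding lower_p_series_approximation_def Let_def by blast
  qed
  show "\<xi> k = \<xi>' k"
  proof (rule sorted_eq_of_min_sum_eq[OF _ _ _ _ _ k])
    show "(\<Sum>k\<in>{1..d}. min t (\<xi> k)) = (\<Sum>k\<in>{1..d}. min t (\<xi>' k))" if "t > 0" for t
      using approximations_min_sum_le[OF assms(1,2,4,5) that]
        approximations_min_sum_le[OF assms(1,2,5,4) that] by simp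
  qed (use D[OF assms(4)] D[OF assms(5)] in auto)
qed

end
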